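(* For every integer $n\ge 3$, let $M(n)$ be the smallest integer $N$ such that every family of $N$ noncrossing convex bodies in general position in the plane has $n$ members in convex position. Then $$M(n)\le N_3(3,n)\le 2^{n^2\log_2 n}.$$
   Context: A convex body is a compact convex set in the plane with nonempty interior. A family $\mathcal C$ of convex bodies is in convex position if no member is contained in the convex hull of the union of the others. $\mathcal C$ is in general position if (1) every three members are in convex position, (2) no two members $C,C'$ have a common tangent line meeting $C\cap C'$, and (3) no three members share a common tangent line. The family is noncrossing if no two members share more than two boundary points. $N_3(q,n)$ is the smallest $N$ such that for every coloring of all 3-element subsets of $[N]$ with $q$ colors there are integers $j_1<\dots<j_n$ in $[N]$ such that all triples $\{j_i,j_{i+1},j_{i+2}\}$, $1\le i\le n-2$, receive the same color. *)

theory Defs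
  imports "HOL-Analysis.Analysis"
begin

type_synonym plane = "real ^ 2"

definition convex_body :: "plane set \<Rightarrow> bool" where
  "convex_body C \<longleftrightarrow> compact C \<and> convex C \<and> interior C \<noteq> {}"

definition convex_position :: "plane set set \<Rightarrow> bool" where
  "convex_position F \<longleftrightarrow> (\<forall>C\<in>F. \<not> C \<subseteq> convex hull (\<Union>(F - {C})))"

text \<open>A tangent is a supporting line: it meets \<open>C\<close> and \<open>C\<close> lies on one closed side of it.
  The normal \<open>a\<close> depends on the body, so a common tangent of two bodies may
  have them on the same side or on opposite sides.\<close>

definition tangent_line :: "plane set \<Rightarrow> plane set \<Rightarrow> bool" where
  "tangent_line L C \<longleftrightarrow>
     (\<exists>a b. a \<noteq> 0 \<and> L = {x. a \<bullet> x = b} \<and> L \<inter> C \<noteq> {} \<and> (\<forall>x\<in>C. a \<bullet> x \<le> b))"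

definition general_position :: "plane set set \<Rightarrow> bool" where
  "general_position F \<longleftrightarrow>
     (\<forall>G\<subseteq>F. card G = 3 \<longrightarrow> convex_position G) \<and>
     (\<forall>C\<in>F. \<forall>D\<in>F. C \<noteq> D \<longrightarrow>
        \<not> (\<exists>L. tangent_line L C \<and> tangent_line L D \<and> L \<inter> (C \<inter> D) \<noteq> {})) \<and>
     (\<forall>G\<subseteq>F. card G = 3 \<longrightarrow> \<not> (\<exists>L. \<forall>C\<in>G. tangent_line L C))"

definition noncrossing :: "plane set set \<Rightarrow> bool" where
  "noncrossing F \<longleftrightarrow>
     (\<forall>C\<in>F. \<forall>D\<in>F. C \<noteq> D \<longrightarrow>
        finite (frontier C \<inter> frontier D) \<and> card (frontier C \<inter> frontier D) \<le> 2)"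

text \<open>Families are sets: repeated members would violate general position anyway.\<close>

definition bodies_property :: "nat \<Rightarrow> nat \<Rightarrow> bool" where
  "bodies_property n N \<longleftrightarrow>
     (\<forall>F. finite F \<and> card F = N \<and> (\<forall>C\<in>F. convex_body C) \<and>
          noncrossing F \<and> general_position F \<longrightarrow>
          (\<exists>G\<subseteq>F. card G = n \<and> convex_position G))"

definition M_bodies :: "nat \<Rightarrow> nat" where
  "M_bodies n = (LEAST N. bodies_property n N)"

definition monotone_path_property :: "nat \<Rightarrow> nat \<Rightarrow> nat \<Rightarrow> bool" where
  "monotone_path_property q n N \<longleftrightarrow>
     (\<forall>col :: nat set \<Rightarrow> nat.
        (\<forall>T\<subseteq>{1..N}. card T = 3 \<longrightarrow> col T \<in> {1..q}) \<longrightarrow>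
        (\<exists>j :: nat \<Rightarrow> nat.
           strict_mono_on {1..n} j \<and> j ` {1..n} \<subseteq> {1..N} \<and>
           (\<exists>c. \<forall>i\<in>{1..n - 2}. col {j i, j (i + 1), j (i + 2)} = c)))"

definition N\<^sub>3 :: "nat \<Rightarrow> nat \<Rightarrow> nat" where
  "N\<^sub>3 q n = (LEAST N. monotone_path_property q n N)"

end

theory Submission
  imports Defs
begin

text \<open>Cut the circle of directions open at a direction where the support functions of the bodies
  are pairwise distinct, and number the bodies so that these values decrease. Because the family
  is noncrossing, the directions in which a later body \<open>j\<close> reaches further than an earlier body
  \<open>i\<close> form an open interval \<open>(a i j, b i j)\<close>: otherwise support points of the two bodies
  would alternate along the boundary of their common hull, the segments joining them would cross,
  and the two boundaries would meet at least four times around the crossing point. A family is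
  in convex position iff each member is on the upper envelope of the support functions. Colour a
  triple
  \<open>i < j < k\<close> according to whether \<open>(a j k, b j k)\<close> is shifted to the right of
  \<open>(a i j, b i j)\<close>, nested in it, or shifted to its left. Along a monochromatic monotone path
  every body is on the envelope: for nested triples this is immediate, and shiftedness is
  transitive, hence passes from consecutive triples to all triples of the path.

  The bound on \<open>N\<^sub>3\<close> comes from counting up-sets of a grid, as in the
  Moshkovitz--Shapira argument.\<close>

section \<open>Monotone paths in coloured triples\<close>

text \<open>Here \<open>m\<close> counts triples, not vertices, and \<open>(i, j)\<close> are the last two vertices.\<close>

fun mono_path :: "(nat set \<Rightarrow> nat) \<Rightarrow> nat \<Rightarrow> nat \<Rightarrow> nat \<Rightarrow> nat \<Rightarrow> bool" where
  "mono_path col c 0 i j \<longleftrightarrow> True"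
| "mono_path col c (Suc m) i j \<longleftrightarrow>
     (\<exists>h\<ge>1. h < i \<and> col {h, i, j} = c \<and> mono_path col c m h i)"

text \<open>Unrolling the recursion gives the vertices themselves, the form in which
  \<open>monotone_path_property\<close> speaks of paths; \<open>m\<close> triples use
  \<open>m + 2\<close> vertices.\<close>

lemma mono_path_vertices:
  assumes "mono_path col c m i j" "1 \<le> i" "i < j"
  shows "\<exists>p. strict_mono_on {1..m + 2} p \<and> p ` {1..m + 2} \<subseteq> {1..j} \<and>
             p (m + 1) = i \<and> p (m + 2) = j \<and>
             (\<forall>r\<in>{1..m}. col {p r, p (r + 1), p (r + 2)} = c)"
  using assms
proof (induction m arbitrary: i j)
  case 0
  let ?p = "\<lambda>r::nat. if r = 1 then i else j"
  have "strict_mono_on {1..2} ?p" using 0 by (auto simp: strict_mono_on_def)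
  then show ?case using 0 by (intro exI[of _ ?p]) (auto simp: numeral_2_eq_2)
next
  case (Suc m)
  then obtain h where h: "1 \<le> h" "h < i" "col {h, i, j} = c" "mono_path col c m h i"
    by auto
  obtain p where p: "strict_mono_on {1..m + 2} p" "p ` {1..m + 2} \<subseteq> {1..i}"
      "p (m + 1) = h" "p (m + 2) = i"
      "\<forall>r\<in>{1..m}. col {p r, p (r + 1), p (r + 2)} = c"
    using Suc.IH[OF h(4) h(1,2)] by blast
  let ?p = "p(m + 3 := j)"
  have below: "1 \<le> p r \<and> p r < j" if "r \<in> {1..m + 2}" for r
    using p(2) that \<open>i < j\<close> by fastforce
  have "strict_mono_on {1..Suc m + 2} ?p"
    unfolding strict_mono_on_def
  proof (intro allI impI)
    fix r s assume "r \<in> {1..Suc m + 2} \<and> s \<in> {1..Suc m + 2} \<and> r < s"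
    then show "?p r < ?p s"
      using below[of r] p(1) by (cases "s = m + 3") (auto simp: strict_mono_on_def)
  qed
  moreover have "?p ` {1..Suc m + 2} \<subseteq> {1..j}"
    using below Suc.prems by (force simp: less_imp_le)
  moreover have "col {?p r, ?p (r + 1), ?p (r + 2)} = c" if "r \<in> {1..Suc m}" for r
  proof (cases "r = Suc m")
    case True
    then show ?thesis using p(3,4) h(3) by (simp add: eval_nat_numeral)
  next
    case False
    then show ?thesis using p(5) that by auto
  qed
  ultimately show ?case
    using p(4) by (intro exI[of _ ?p] conjI ballI) (simp_all add: fun_upd_def)
qed

text \<open>Attach to each pair \<open>i < j\<close> the vector of lengths of the longest monochromatic paths
  ending in \<open>(i, j)\<close>. The vectors of the pairs starting at \<open>i\<close> generate an up-set
  of the grid, and these up-sets are pairwise distinct; an up-set is encoded by the height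
  function \<open>height\<close> of its complement over the first \<open>q - 1\<close> coordinates.\<close>

lemma monotone_path_property_large:
  assumes q: "1 \<le> q" and n: "2 \<le> n" and N: "(n - 1) ^ ((n - 2) ^ (q - 1)) < N"
  shows "monotone_path_property q n N"
  unfolding monotone_path_property_def
proof (intro allI impI, rule ccontr)
  fix col :: "nat set \<Rightarrow> nat"
  assume col: "\<forall>T\<subseteq>{1..N}. card T = 3 \<longrightarrow> col T \<in> {1..q}"
  assume no: "\<not> (\<exists>j. strict_mono_on {1..n} j \<and> j ` {1..n} \<subseteq> {1..N} \<and>
           (\<exists>c. \<forall>i\<in>{1..n - 2}. col {j i, j (i + 1), j (i + 2)} = c))"
  \<comment> \<open>A path with \<open>n - 2\<close> triples has \<open>n\<close> vertices, which
    \<open>no\<close> forbids.\<close>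
  have bound: "m < n - 2" if path: "mono_path col c m i j" "1 \<le> i" "i < j" "j \<le> N" for c m i j
  proof (rule ccontr)
    assume "\<not> m < n - 2"
    then have sub: "{1..n} \<subseteq> {1..m + 2}" "{1..n - 2} \<subseteq> {1..m}" by auto
    obtain p where p: "strict_mono_on {1..m + 2} p" "p ` {1..m + 2} \<subseteq> {1..j}"
        "\<forall>r\<in>{1..m}. col {p r, p (r + 1), p (r + 2)} = c"
      using mono_path_vertices[OF path(1-3)] by blast
    have "strict_mono_on {1..n} p" using p(1) sub(1) by (rule monotone_on_subset)
    moreover have "p ` {1..n} \<subseteq> {1..N}"
      using image_mono[OF sub(1), of p] p(2) path(4) by fastforce
    ultimately have "strict_mono_on {1..n} p \<and> p ` {1..n} \<subseteq> {1..N} \<and>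
        (\<forall>r\<in>{1..n - 2}. col {p r, p (r + 1), p (r + 2)} = c)"
      using p(3) sub(2) by blast
    then show False using no by blast
  qed
  \<comment> \<open>For pairs in range \<open>Max\<close> is meaningful: the set is finite by
    \<open>bound\<close>, and it contains 0 because no triples at all count as a path.\<close>
  define v where "v c i j = Max {m. mono_path col c m i j}" for c i j
  have fin: "finite {m. mono_path col c m i j}" if "1 \<le> i" "i < j" "j \<le> N" for c i j
    using bound[OF _ that] by (intro finite_subset[OF _ finite_lessThan[of "n - 2"]]) auto
  have v_path: "mono_path col c (v c i j) i j" if "1 \<le> i" "i < j" "j \<le> N" for c i j
    using Max_in[OF fin[OF that]] unfolding v_def
    by (metis (no_types, lifting) empty_iff mem_Collect_eq mono_path.simps(1))
  have v_less: "v c i j < n - 2" if "1 \<le> i" "i < j" "j \<le> N" for c i j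
    using bound v_path that by blast
  \<comment> \<open>Appending \<open>k\<close> prolongs a longest path ending in
    \<open>(i, j)\<close> whose colour is that of the triple.\<close>
  have v_step: "v (col {i, j, k}) i j < v (col {i, j, k}) j k"
    if "1 \<le> i" "i < j" "j < k" "k \<le> N" for i j k
  proof -
    have "mono_path col (col {i, j, k}) (Suc (v (col {i, j, k}) i j)) j k"
      using v_path[of i j] that by auto
    then have "Suc (v (col {i, j, k}) i j) \<le> v (col {i, j, k}) j k"
      unfolding v_def[of _ j k] using fin[of j k] that by (intro Max_ge) auto
    then show ?thesis by simp
  qed
  define X where "X = ({1..<q} \<rightarrow>\<^sub>E {..<n - 2})"
  define cand where
    "cand i x = {v q i k | k. i < k \<and> k \<le> N \<and> (\<forall>c\<in>{1..<q}. v c i k \<le> x c)}" for i x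
  \<comment> \<open>\<open>height i x\<close> is the least last coordinate among the vectors of
    pairs \<open>(i, k)\<close> whose other coordinates are at most \<open>x\<close>. The default
    \<open>n - 2\<close>, one above every possible length, means that there is no such pair; hence
    \<open>n - 1\<close> possible values.\<close>
  define height where "height i = (\<lambda>x\<in>X. Min (insert (n - 2) (cand i x)))" for i
  have cand_fin: "finite (cand i x)" for i x
    by (rule finite_subset[of _ "v q i ` {..N}"]) (auto simp: cand_def)
  have distinct: "height i \<noteq> height j" if "1 \<le> i" "i < j" "j \<le> N" for i j
  proof
    assume eq: "height i = height j"
    \<comment> \<open>The heights are tested at the vector of \<open>(i, j)\<close> itself. There
      \<open>height i x \<le> v q i j\<close>, so equal heights yield a pair \<open>(j, k)\<close>
      whose vector is nowhere larger than that of \<open>(i, j)\<close>, against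
      \<open>v_step\<close> for the colour of \<open>{i, j, k}\<close>.\<close>
    define x where "x = (\<lambda>c\<in>{1..<q}. v c i j)"
    have x: "x \<in> X" unfolding X_def x_def using v_less[OF that] by auto
    have "v q i j \<in> cand i x" unfolding cand_def x_def using that by auto
    then have "height i x \<le> v q i j"
      unfolding height_def using x cand_fin by (auto intro!: Min_le)
    then have small: "Min (insert (n - 2) (cand j x)) \<le> v q i j"
      using x eq unfolding height_def by (metis restrict_apply')
    have "Min (insert (n - 2) (cand j x)) \<in> insert (n - 2) (cand j x)"
      using cand_fin by (intro Min_in) auto
    then have "Min (insert (n - 2) (cand j x)) \<in> cand j x"
      using small v_less[OF that, of q] by auto
    then obtain k where k: "j < k" "k \<le> N" "\<forall>c\<in>{1..<q}. v c j k \<le> x c" "v q j k \<le> v q i j"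
      using small unfolding cand_def by force
    have below: "v c j k \<le> v c i j" if "c \<in> {1..q}" for c
      using k that unfolding x_def by (cases "c = q") auto
    have "card {i, j, k} = 3" using that k by auto
    then have "col {i, j, k} \<in> {1..q}" using col that k by auto
    then show False using below v_step[of i j k] that k by force
  qed
  have "inj_on height {1..N}"
  proof (rule inj_onI)
    fix i j assume "i \<in> {1..N}" "j \<in> {1..N}" "height i = height j"
    then show "i = j" using distinct[of i j] distinct[of j i]
      by (cases i j rule: linorder_cases) auto
  qed
  moreover have "height i \<in> X \<rightarrow>\<^sub>E {..<n - 1}" for i
  proof -
    have "Min (insert (n - 2) (cand i x)) \<le> n - 2" for x
      using cand_fin by (intro Min_le) auto
    moreover have "n - 2 < n - 1" using n by auto
    ultimately have "Min (insert (n - 2) (cand i x)) \<in> {..<n - 1}" for x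
      by (meson lessThan_iff order_le_less_trans)
    then show ?thesis unfolding height_def by simp
  qed
  moreover have "finite X" unfolding X_def by (intro finite_PiE) auto
  ultimately have "card {1..N} \<le> card (X \<rightarrow>\<^sub>E {..<n - 1})"
    by (intro card_inj_on_le[of height] finite_PiE) auto
  also have "\<dots> = (n - 1) ^ ((n - 2) ^ (q - 1))"
    using \<open>finite X\<close> by (simp add: card_PiE X_def)
  finally show False using N by simp
qed

text \<open>For three colours there are \<open>(n - 1) ^ ((n - 2) ^ 2)\<close> height functions; the
  coarser \<open>n ^ n\<^sup>2\<close> is the bound of the theorem written in base
  \<open>n\<close>.\<close>

lemma monotone_path_property_3:
  assumes "n \<ge> 3" shows "monotone_path_property 3 n (n ^ n\<^sup>2)"
proof (rule monotone_path_property_large)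
  have "(n - 1) ^ ((n - 2) ^ (3 - 1)) \<le> n ^ ((n - 2) ^ (3 - 1))"
    by (intro power_mono) auto
  also have "\<dots> < n ^ n\<^sup>2"
    using assms by (intro power_strict_increasing) (auto intro: power_strict_mono)
  finally show "(n - 1) ^ ((n - 2) ^ (3 - 1)) < n ^ n\<^sup>2" .
qed (use assms in auto)

text \<open>A constant colouring already forces \<open>n\<close> distinct vertices. This later
  guarantees at least three bodies.\<close>

lemma monotone_path_property_imp_ge:
  assumes "monotone_path_property q n N" "1 \<le> q" shows "n \<le> N"
proof -
  obtain j where "strict_mono_on {1..n} j" "j ` {1..n} \<subseteq> {1..N}"
    using assms unfolding monotone_path_property_def
    by (elim allE[of _ "\<lambda>_. 1"]) auto
  then show ?thesis
    using card_inj_on_le[of j "{1..n}" "{1..N}"] strict_mono_on_imp_inj_on by auto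
qed

section \<open>Upper envelopes\<close>

text \<open>The functions \<open>f i\<close> live on \<open>[0, R]\<close>, a circle cut open at a point where they decrease in
  \<open>i\<close>.\<close>

locale pseudocircles =
  fixes X :: "nat set" and R :: real
    and f :: "nat \<Rightarrow> real \<Rightarrow> real" and a b :: "nat \<Rightarrow> nat \<Rightarrow> real"
  assumes R_pos: "0 < R"
    and ends: "\<lbrakk>i \<in> X; j \<in> X; i < j\<rbrakk> \<Longrightarrow> 0 < a i j \<and> a i j < b i j \<and> b i j < R"
    and less_iff: "\<lbrakk>i \<in> X; j \<in> X; i < j; t \<in> {0..R}\<rbrakk>
        \<Longrightarrow> f i t < f j t \<longleftrightarrow> a i j < t \<and> t < b i j"
    and greater_iff: "\<lbrakk>i \<in> X; j \<in> X; i < j; t \<in> {0..R}\<rbrakk>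
        \<Longrightarrow> f j t < f i t \<longleftrightarrow> t < a i j \<or> b i j < t"
    and no_triple: "\<lbrakk>i \<in> X; j \<in> X; k \<in> X; i < j; j < k; t \<in> {0..R}\<rbrakk>
        \<Longrightarrow> \<not> (f i t = f j t \<and> f j t = f k t)"
    and middle_visible: "\<lbrakk>i \<in> X; j \<in> X; k \<in> X; i < j; j < k\<rbrakk>
        \<Longrightarrow> \<exists>t\<in>{0..R}. f i t < f j t \<and> f k t < f j t"
    and last_visible: "\<lbrakk>i \<in> X; j \<in> X; k \<in> X; i < j; j < k\<rbrakk>
        \<Longrightarrow> \<exists>t\<in>{0..R}. f i t < f k t \<and> f j t < f k t"
begin

lemma ends_in:
  assumes "i \<in> X" "j \<in> X" "i < j"
  shows "a i j \<in> {0..R}" "b i j \<in> {0..R}"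
  using ends[OF assms] by auto

lemma eq_at_ends:
  assumes "i \<in> X" "j \<in> X" "i < j"
  shows "f i (a i j) = f j (a i j)" "f i (b i j) = f j (b i j)"
  using less_iff[OF assms] greater_iff[OF assms] ends_in[OF assms] ends[OF assms]
  by (metis less_irrefl linorder_cases order.asym)+

text \<open>A shared endpoint would be a point where three of the functions agree.\<close>

lemma ends_neq:
  assumes "i \<in> X" "j \<in> X" "k \<in> X" "i < j" "j < k"
  shows "a i j \<noteq> a j k" "b i j \<noteq> b j k"
  using no_triple[OF assms] eq_at_ends[of i j] eq_at_ends[of j k] ends_in[of i j] assms
  by metis+

text \<open>A point where \<open>k\<close> is above both others lies in both
  \<open>(a i k, b i k)\<close> and \<open>(a j k, b j k)\<close>.\<close>

lemma last_overlap:
  assumes "i \<in> X" "j \<in> X" "k \<in> X" "i < j" "j < k"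
  shows "a i k < b j k" "a j k < b i k"
proof -
  obtain t where "t \<in> {0..R}" "f i t < f k t" "f j t < f k t"
    using last_visible[OF assms] by blast
  then show "a i k < b j k" "a j k < b i k"
    using less_iff[of i k t] less_iff[of j k t] assms by auto
qed

lemma middle_witness:
  assumes "i \<in> X" "j \<in> X" "k \<in> X" "i < j" "j < k"
  obtains t where "a i j < t" "t < b i j" "t < a j k \<or> b j k < t"
  using middle_visible[OF assms] less_iff[of i j] greater_iff[of j k] assms by blast

section \<open>Shifted triples and their transitivity\<close>

definition shifted :: "nat \<Rightarrow> nat \<Rightarrow> nat \<Rightarrow> bool" where
  "shifted i j k \<longleftrightarrow> a i j < a j k \<and> b i j < b j k"

text \<open>The witness for \<open>j\<close> lies in \<open>(a i j, b i j)\<close> but outside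
  \<open>[a j k, b j k]\<close>, so the first interval is not contained in the second. This leaves
  three of the four orders of the endpoints.\<close>

lemma not_inverse_nested:
  assumes "i \<in> X" "j \<in> X" "k \<in> X" "i < j" "j < k"
  shows "a i j < a j k \<or> b j k < b i j"
  using middle_witness[OF assms] by fastforce

text \<open>Each inequality is proved by contradiction at an endpoint of an interval: two functions
  agree there, so a strict comparison of one of them with a third carries over to the other and puts
  the endpoint on the wrong side.\<close>

lemma shifted_trans:
  assumes X: "i \<in> X" "j \<in> X" "k \<in> X" "l \<in> X" and lt: "i < j" "j < k" "k < l"
    and ijk: "shifted i j k" and jkl: "shifted j k l"
  shows "shifted i j l" "shifted i k l"
proof -
  note ord = X lt less_trans[OF lt(1,2)] less_trans[OF lt(2,3)]
  have eqs: "a i j < a j k" "b i j < b j k" "a j k < a k l" "b j k < b k l"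
    using ijk jkl by (auto simp: shifted_def)
  have "a i k < a k l"
  proof (rule ccontr)
    assume neg: "\<not> a i k < a k l"
    obtain t where t: "a i k < t" "t < b i k" "t < a k l \<or> b k l < t"
      using middle_witness[of i k l] ord by blast
    \<comment> \<open>Otherwise \<open>f i\<close> is below \<open>f j\<close> at
      \<open>a j k\<close>, where \<open>f j\<close> and \<open>f k\<close> agree, so
      \<open>a i k < a j k < a k l\<close>.\<close>
    have "b i j \<le> a j k"
    proof (rule ccontr)
      assume "\<not> b i j \<le> a j k"
      then have "f i (a j k) < f j (a j k)"
        using less_iff[of i j "a j k"] ord eqs ends_in[of j k] by auto
      then have "f i (a j k) < f k (a j k)" using eq_at_ends[of j k] ord by simp
      then show False using less_iff[of i k "a j k"] ord ends_in[of j k] neg eqs by auto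
    qed
    \<comment> \<open>The witness \<open>t\<close> gives \<open>b k l < b i k\<close>, so
      \<open>b i k\<close> lies beyond both \<open>b i j\<close> and \<open>b j k\<close>.\<close>
    then have "f j (b i k) < f i (b i k)"
      using greater_iff[of i j "b i k"] ord ends_in[of i k] ends[of i k] neg eqs by auto
    then have "f j (b i k) < f k (b i k)" using eq_at_ends[of i k] ord by simp
    then show False using less_iff[of j k "b i k"] ord ends_in[of i k] neg eqs t by auto
  qed
  moreover have "b i k < b k l"
  proof (rule ccontr)
    assume neg: "\<not> b i k < b k l"
    have "f j (b j k) < f i (b j k)"
      using greater_iff[of i j "b j k"] ord ends_in[of j k] eqs by auto
    then have "f k (b j k) < f i (b j k)" using eq_at_ends[of j k] ord by simp
    then show False
      using greater_iff[of i k "b j k"] ord ends_in[of j k] neg eqs last_overlap[of i j k] by auto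
  qed
  ultimately show "shifted i k l" by (simp add: shifted_def)
  have "a i j < a j l"
  proof (rule ccontr)
    assume neg: "\<not> a i j < a j l"
    have "f k (a j l) < f j (a j l)"
      using greater_iff[of j k "a j l"] ord ends_in[of j l] eqs neg by auto
    then have "f k (a j l) < f l (a j l)" using eq_at_ends[of j l] ord by simp
    then show False using less_iff[of k l "a j l"] ord ends_in[of j l] neg eqs by auto
  qed
  moreover have "b i j < b j l"
  proof (rule ccontr)
    assume neg: "\<not> b i j < b j l"
    have kl: "a k l < b j l" using last_overlap[of j k l] ord by auto
    then have "f j (b j l) < f k (b j l)"
      using less_iff[of j k "b j l"] ord ends_in[of j l] eqs neg by auto
    then have "f l (b j l) < f k (b j l)" using eq_at_ends[of j l] ord by simp
    then show False using greater_iff[of k l "b j l"] ord ends_in[of j l] neg eqs kl by auto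
  qed
  ultimately show "shifted i j l" by (simp add: shifted_def)
qed

text \<open>Induction on \<open>t - r\<close>: one more vertex, \<open>r + 1\<close> or (if that is
  \<open>s\<close>) \<open>r + 2\<close>, is inserted, and \<open>shifted_trans\<close> joins two
  shorter triples and drops it again.\<close>

lemma shifted_path_all:
  fixes n :: nat
  assumes p: "strict_mono_on {1..n} p" "p ` {1..n} \<subseteq> X"
    and consec: "\<And>r. r \<in> {1..n - 2} \<Longrightarrow> shifted (p r) (p (r + 1)) (p (r + 2))"
    and "1 \<le> r" "r < s" "s < t" "t \<le> n"
  shows "shifted (p r) (p s) (p t)"
  using assms(4-)
proof (induction "t - r" arbitrary: r s t rule: less_induct)
  case less
  have inX: "p m \<in> X" if "1 \<le> m" "m \<le> n" for m using p(2) that by auto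
  have mono: "p m < p m'" if "1 \<le> m" "m < m'" "m' \<le> n" for m m'
    using p(1) that by (auto simp: strict_mono_on_def)
  consider "s = r + 1" "t = r + 2" | "s = r + 1" "r + 2 < t" | "r + 1 < s"
    using less.prems by linarith
  then show ?case
  proof cases
    case 1
    then have "r \<in> {1..n - 2}" using less.prems by auto
    then show ?thesis unfolding 1 by (rule consec)
  next
    case 2
    have "shifted (p r) (p (r + 1)) (p (r + 2))" using consec[of r] 2 less.prems by auto
    moreover have "shifted (p (r + 1)) (p (r + 2)) (p t)" using less.hyps 2 less.prems by auto
    ultimately show ?thesis
      using shifted_trans(1)[of "p r" "p (r + 1)" "p (r + 2)" "p t"] inX mono 2 less.prems by auto
  next
    case 3
    have "shifted (p r) (p (r + 1)) (p s)" using less.hyps 3 less.prems by auto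
    moreover have "shifted (p (r + 1)) (p s) (p t)" using less.hyps 3 less.prems by auto
    ultimately show ?thesis
      using shifted_trans(2)[of "p r" "p (r + 1)" "p s" "p t"] inX mono 3 less.prems by auto
  qed
qed

section \<open>Visibility along monochromatic paths\<close>

text \<open>A suitable \<open>t\<close> lies to the right of all \<open>a i k\<close> and to the
  left of all \<open>b i k\<close> with \<open>i < k\<close> and all \<open>a k l\<close> with
  \<open>k < l\<close>: there \<open>k\<close> has overtaken every earlier function and no later one
  has overtaken \<open>k\<close>. By \<open>last_overlap\<close> and \<open>sh\<close> each lower
  bound is below each upper bound.\<close>

lemma visible_if_shifted:
  assumes Y: "Y \<subseteq> X" "finite Y" and k: "k \<in> Y"
    and sh: "\<And>i l. \<lbrakk>i \<in> Y; l \<in> Y; i < k; k < l\<rbrakk> \<Longrightarrow> a i k < a k l"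
  shows "\<exists>t\<in>{0..R}. \<forall>i\<in>Y - {k}. f i t < f k t"
proof -
  define lo where "lo = insert 0 ((\<lambda>i. a i k) ` {i \<in> Y. i < k})"
  define up where "up = insert R ((\<lambda>i. b i k) ` {i \<in> Y. i < k} \<union> (\<lambda>l. a k l) ` {l \<in> Y. k < l})"
  have fin: "finite lo" "finite up" "lo \<noteq> {}" "up \<noteq> {}"
    using Y by (auto simp: lo_def up_def)
  have inX: "i \<in> X" if "i \<in> Y" for i using that Y by auto
  have ab: "a i k < b i' k" if "i \<in> Y" "i' \<in> Y" "i < k" "i' < k" for i i'
    using last_overlap[of i i' k] last_overlap[of i' i k] ends[of i k] that inX k
    by (cases i i' rule: linorder_cases) auto
  have "x < y" if "x \<in> lo" "y \<in> up" for x y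
  proof -
    have "0 < a i k \<and> a i k < R \<and> 0 < b i k" if "i \<in> Y" "i < k" for i
      using ends[of i k] that inX k by auto
    moreover have "0 < a k l" if "l \<in> Y" "k < l" for l
      using ends[of k l] that inX k by auto
    ultimately show ?thesis
      using that ab sh R_pos unfolding lo_def up_def by auto
  qed
  then have "Max lo < Min up" using fin by auto
  then obtain t where t: "Max lo < t" "t < Min up" using dense by blast
  then have tl: "x < t" if "x \<in> lo" for x using that fin by auto
  have tu: "t < x" if "x \<in> up" for x using that fin t by auto
  have t0: "t \<in> {0..R}" using tl[of 0] tu[of R] by (auto simp: lo_def up_def)
  have "f i t < f k t" if "i \<in> Y" "i \<noteq> k" for i
  proof (cases "i < k")
    case True
    then show ?thesis
      using less_iff[of i k t] tl[of "a i k"] tu[of "b i k"] t0 inX that k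
      by (auto simp: lo_def up_def)
  next
    case False
    then show ?thesis
      using greater_iff[of k i t] tu[of "a k i"] t0 inX that k by (auto simp: up_def)
  qed
  then show ?thesis using t0 by blast
qed

text \<open>Consecutive comparisons suffice. The point \<open>t\<close> lies in the interval of the
  pair \<open>(m - 1, m)\<close> and to the left of that of \<open>(m, m + 1)\<close>; by nesting,
  the values at \<open>t\<close> increase along the path up to \<open>m\<close> and decrease after
  it.\<close>

lemma visible_if_nested:
  fixes n :: nat
  assumes p: "strict_mono_on {1..n} p" "p ` {1..n} \<subseteq> X"
    and nested: "\<And>r. r \<in> {1..n - 2} \<Longrightarrow>
      a (p r) (p (r + 1)) < a (p (r + 1)) (p (r + 2)) \<and>
      b (p (r + 1)) (p (r + 2)) < b (p r) (p (r + 1))"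
    and m: "m \<in> {1..n}" and "2 \<le> n"
  shows "\<exists>t\<in>{0..R}. \<forall>i\<in>{1..n} - {m}. f (p i) t < f (p m) t"
proof -
  let ?a = "\<lambda>r. a (p r) (p (r + 1))" and ?b = "\<lambda>r. b (p r) (p (r + 1))"
  have inX: "p r \<in> X" if "1 \<le> r" "r \<le> n" for r using p(2) that by auto
  have mono: "p r < p s" if "1 \<le> r" "r < s" "s \<le> n" for r s
    using p(1) that by (auto simp: strict_mono_on_def)
  have e: "0 < ?a r \<and> ?a r < ?b r \<and> ?b r < R" if "1 \<le> r" "r < n" for r
    using ends[of "p r" "p (r + 1)"] inX mono that by auto
  have ab: "?a r \<le> ?a s \<and> ?b s \<le> ?b r" if "1 \<le> r" "r \<le> s" "s < n" for r s
    using that(2,3)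
  proof (induction s rule: dec_induct)
    case (step s)
    then show ?case using nested[of s] that(1) by fastforce
  qed auto
  have "\<exists>t\<in>{0..R}. (1 < m \<longrightarrow> ?a (m - 1) < t \<and> t < ?b (m - 1)) \<and> (m < n \<longrightarrow> t < ?a m)"
  proof (cases "m = 1")
    case True
    \<comment> \<open>The first vertex has no predecessor to overtake, so the cut point itself
      works.\<close>
    then show ?thesis using e[of 1] \<open>2 \<le> n\<close> by (intro bexI[of _ 0]) auto
  next
    case False
    then have m1: "1 \<le> m - 1" "m - 1 < n" "m - 1 + 1 = m" using m by auto
    show ?thesis
    proof (cases "m < n")
      case True
      then have "m - 1 \<in> {1..n-2}" "m - 1 + 2 = m + 1" using m1 by auto
      then have "?a (m - 1) < ?a m" using nested[of "m - 1"] m1 by auto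
      then obtain t where "?a (m - 1) < t" "t < min (?a m) (?b (m - 1))"
        using e[OF m1(1,2)] dense[of "?a (m - 1)" "min (?a m) (?b (m - 1))"] by auto
      then show ?thesis using e[OF m1(1,2)] by (intro bexI[of _ t]) auto
    next
      case False
      obtain t where "?a (m - 1) < t" "t < ?b (m - 1)"
        using e[OF m1(1,2)] dense[of "?a (m - 1)" "?b (m - 1)"] by auto
      then show ?thesis using e[OF m1(1,2)] False by (intro bexI[of _ t]) auto
    qed
  qed
  then obtain t where t: "t \<in> {0..R}" "1 < m \<Longrightarrow> ?a (m - 1) < t \<and> t < ?b (m - 1)"
      "m < n \<Longrightarrow> t < ?a m"
    by blast
  have up: "f (p r) t < f (p (r + 1)) t" if "1 \<le> r" "r < m" for r
  proof -
    have "r \<le> m - 1" "m - 1 < n" "1 < m" using that m by auto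
    then have "?a r < t" "t < ?b r" using ab[of r "m - 1"] t(2) that by auto
    then show ?thesis
      using less_iff[of "p r" "p (r + 1)" t] inX[of r] inX[of "r + 1"] mono[of r "r + 1"]
        t(1) that m by auto
  qed
  have down: "f (p (r + 1)) t < f (p r) t" if "m \<le> r" "r < n" for r
    using greater_iff[of "p r" "p (r + 1)" t] inX[of r] inX[of "r + 1"] mono[of r "r + 1"]
      ab[of m r] t that m by auto
  have "f (p i) t < f (p s) t" if "1 \<le> i" "i < s" "s \<le> m" for i s
    using Suc_leI[OF that(2)] that(3)
  proof (induction s rule: dec_induct)
    case base
    then show ?case using up[of i] that(1) by simp
  next
    case (step s)
    then show ?case using up[of s] that(1) by simp
  qed
  moreover have "f (p s) t < f (p m) t" if "m < s" "s \<le> n" for s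
    using Suc_leI[OF that(1)] that(2)
  proof (induction s rule: dec_induct)
    case base
    then show ?case using down[of m] by simp
  next
    case (step s)
    then show ?case using down[of s] by simp
  qed
  ultimately have "\<forall>i\<in>{1..n} - {m}. f (p i) t < f (p m) t"
    by (metis DiffE atLeastAtMost_iff insertI1 linorder_neqE_nat order.refl)
  then show ?thesis using t(1) by blast
qed

text \<open>Running through the circle backwards swaps left and right endpoints, which turns the
  third pattern into the shifted one.\<close>

lemma mirror:
  "pseudocircles X R (\<lambda>i t. f i (R - t)) (\<lambda>i j. R - b i j) (\<lambda>i j. R - a i j)"
proof
  fix i j k assume X: "i \<in> X" "j \<in> X" "k \<in> X" "i < j" "j < k"
  obtain t where "t \<in> {0..R}" "f i t < f j t" "f k t < f j t"
    using middle_visible[OF X] by blast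
  then show "\<exists>t\<in>{0..R}. f i (R - t) < f j (R - t) \<and> f k (R - t) < f j (R - t)"
    by (intro bexI[of _ "R - t"]) auto
  obtain t where "t \<in> {0..R}" "f i t < f k t" "f j t < f k t"
    using last_visible[OF X] by blast
  then show "\<exists>t\<in>{0..R}. f i (R - t) < f k (R - t) \<and> f j (R - t) < f k (R - t)"
    by (intro bexI[of _ "R - t"]) auto
next
  fix i j assume X: "i \<in> X" "j \<in> X" "i < j"
  show "0 < R - b i j \<and> R - b i j < R - a i j \<and> R - a i j < R"
    using ends[OF X] by auto
  fix t assume "t \<in> {0..R}"
  then have t: "R - t \<in> {0..R}" by auto
  show "f i (R - t) < f j (R - t) \<longleftrightarrow> R - b i j < t \<and> t < R - a i j"
    "f j (R - t) < f i (R - t) \<longleftrightarrow> t < R - b i j \<or> R - a i j < t"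
    using less_iff[OF X t] greater_iff[OF X t] by auto
next
  fix i j k t assume "i \<in> X" "j \<in> X" "k \<in> X" "i < j" "j < k" "t \<in> {0..R}"
  then show "\<not> (f i (R - t) = f j (R - t) \<and> f j (R - t) = f k (R - t))"
    using no_triple[of i j k "R - t"] by auto
qed (rule R_pos)

lemma visible_if_shifted_path:
  fixes n :: nat
  assumes p: "strict_mono_on {1..n} p" "p ` {1..n} \<subseteq> X"
    and consec: "\<And>r. r \<in> {1..n - 2} \<Longrightarrow> shifted (p r) (p (r + 1)) (p (r + 2))"
    and m: "m \<in> {1..n}"
  shows "\<exists>t\<in>{0..R}. \<forall>i\<in>{1..n} - {m}. f (p i) t < f (p m) t"
proof -
  have mono: "i < j" if "p i < p j" "i \<in> {1..n}" "j \<in> {1..n}" for i j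
    using p(1) that by (meson leD linorder_not_less strict_mono_on_leD)
  have "a i (p m) < a (p m) l"
    if il: "i \<in> p ` {1..n}" "l \<in> p ` {1..n}" "i < p m" "p m < l" for i l
  proof -
    obtain r s where "i = p r" "l = p s" "r \<in> {1..n}" "s \<in> {1..n}" using il by blast
    then show ?thesis
      using shifted_path_all[OF p consec, of r m s] mono[of r m] mono[of m s] il m
      by (auto simp: shifted_def)
  qed
  then obtain t where "t \<in> {0..R}" "\<forall>i\<in>p ` {1..n} - {p m}. f i t < f (p m) t"
    using visible_if_shifted[of "p ` {1..n}" "p m"] p(2) m by auto
  moreover have "p i \<noteq> p m" if "i \<in> {1..n} - {m}" for i
    using strict_mono_on_imp_inj_on[OF p(1)] m that by (auto dest: inj_onD)
  ultimately show ?thesis by (intro bexI[of _ t]) auto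
qed

text \<open>The upper envelope of \<open>i, j, k\<close> reads \<open>j\<close> before \<open>k\<close> only (1), \<open>j\<close> both before and after
  \<open>k\<close> (2), or \<open>j\<close> after \<open>k\<close> only (3). The two relations ``before'' and ``after'' alone are
  not transitive, which is why three colours are needed.\<close>

definition pattern :: "nat \<Rightarrow> nat \<Rightarrow> nat \<Rightarrow> nat" where
  "pattern i j k =
    (if shifted i j k then 1 else if a i j < a j k then 2 else 3)"

text \<open>\<open>ends_neq\<close> excludes ties and \<open>not_inverse_nested\<close> the fourth
  order of the endpoints, so each number stands for a single strict order.\<close>

lemma pattern_iff:
  assumes "i \<in> X" "j \<in> X" "k \<in> X" "i < j" "j < k"
  shows "pattern i j k = 1 \<longleftrightarrow> shifted i j k"
    "pattern i j k = 2 \<longleftrightarrow> a i j < a j k \<and> b j k < b i j"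
    "pattern i j k = 3 \<longleftrightarrow> a j k < a i j \<and> b j k < b i j"
  using ends_neq[OF assms] not_inverse_nested[OF assms] by (auto simp: pattern_def shifted_def)

lemma visible_if_pattern_path:
  fixes n :: nat
  assumes p: "strict_mono_on {1..n} p" "p ` {1..n} \<subseteq> X"
    and consec: "\<And>r. r \<in> {1..n - 2} \<Longrightarrow> pattern (p r) (p (r + 1)) (p (r + 2)) = c"
    and m: "m \<in> {1..n}" and n: "3 \<le> n"
  shows "\<exists>t\<in>{0..R}. \<forall>i\<in>{1..n} - {m}. f (p i) t < f (p m) t"
proof -
  have triple: "p r \<in> X \<and> p (r + 1) \<in> X \<and> p (r + 2) \<in> X \<and> p r < p (r + 1) \<and> p (r + 1) < p (r + 2)"
    if "r \<in> {1..n - 2}" for r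
  proof -
    have "r \<in> {1..n}" "r + 1 \<in> {1..n}" "r + 2 \<in> {1..n}" using that by auto
    then show ?thesis using p unfolding strict_mono_on_def by (simp add: image_subset_iff)
  qed
  have "pattern (p 1) (p (1 + 1)) (p (1 + 2)) = c" using consec n by simp
  then consider "c = 1" | "c = 2" | "c = 3" unfolding pattern_def by metis
  then show ?thesis
  proof cases
    case 1
    have "shifted (p r) (p (r + 1)) (p (r + 2))" if "r \<in> {1..n - 2}" for r
      using consec[OF that] pattern_iff(1) triple[OF that] 1 by simp
    then show ?thesis using visible_if_shifted_path[OF p _ m] by blast
  next
    case 2
    have "a (p r) (p (r + 1)) < a (p (r + 1)) (p (r + 2)) \<and>
        b (p (r + 1)) (p (r + 2)) < b (p r) (p (r + 1))" if "r \<in> {1..n - 2}" for r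
      using consec[OF that] pattern_iff(2) triple[OF that] 2 by simp
    then show ?thesis using visible_if_nested[OF p _ m] n by simp
  next
    case 3
    interpret mir: pseudocircles X R "\<lambda>i t. f i (R - t)" "\<lambda>i j. R - b i j" "\<lambda>i j. R - a i j"
      by (rule mirror)
    have "mir.shifted (p r) (p (r + 1)) (p (r + 2))" if "r \<in> {1..n - 2}" for r
      using consec[OF that] pattern_iff(3) triple[OF that] 3 by (simp add: mir.shifted_def)
    then obtain t where "t \<in> {0..R}" "\<forall>i\<in>{1..n} - {m}. f (p i) (R - t) < f (p m) (R - t)"
      using mir.visible_if_shifted_path[OF p _ m] by blast
    then show ?thesis by (intro bexI[of _ "R - t"]) auto
  qed
qed

end

section \<open>Crossing segments\<close>

definition dir :: "real \<Rightarrow> plane" where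
  "dir \<theta> = vector [cos \<theta>, sin \<theta>]"

lemma inner_dir: "dir \<theta> \<bullet> x = cos \<theta> * x $ 1 + sin \<theta> * x $ 2"
  by (simp add: dir_def inner_vec_def sum_2)

lemma norm_dir [simp]: "norm (dir \<theta>) = 1"
  by (simp add: norm_eq_1 inner_dir) (simp add: dir_def flip: power2_eq_square)

lemma dir_nonzero [simp]: "dir \<theta> \<noteq> 0"
  by (metis norm_dir norm_zero zero_neq_one)

lemma dir_add_2pi [simp]: "dir (\<theta> + 2 * pi) = dir \<theta>"
  by (simp add: dir_def)

lemma dir_add_pi: "dir (\<theta> + pi) = - dir \<theta>"
  by (simp add: dir_def vec_eq_iff forall_2)

lemma continuous_on_dir: "continuous_on S dir"
proof -
  have dir_eq: "dir = (\<lambda>\<theta>. cos \<theta> *\<^sub>R axis 1 1 + sin \<theta> *\<^sub>R axis 2 1)"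
    by (auto simp: dir_def vec_eq_iff forall_2 axis_def)
  show ?thesis unfolding dir_eq by (intro continuous_intros)
qed

text \<open>For \<open>a \<le> b \<le> c\<close> with \<open>c - a\<close> strictly between 0 and
  \<open>pi\<close>, this expresses \<open>dir b\<close> as a nonnegative combination of
  \<open>dir a\<close> and \<open>dir c\<close>.\<close>

lemma dir_combination:
  "sin (c - a) * (dir b \<bullet> d) = sin (c - b) * (dir a \<bullet> d) + sin (b - a) * (dir c \<bullet> d)"
  by (simp add: inner_dir sin_diff algebra_simps)

lemma polar_decomposition:
  fixes v :: plane
  assumes "v \<noteq> 0"
  obtains r \<phi> where "0 < r" "v = r *\<^sub>R dir \<phi>"
proof -
  have "(v $ 1 / norm v)\<^sup>2 + (v $ 2 / norm v)\<^sup>2 = (v \<bullet> v) / (norm v)\<^sup>2"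
    by (simp add: power_divide inner_vec_def sum_2 power2_eq_square add_divide_distrib)
  also have "\<dots> = 1" using assms by (simp add: power2_norm_eq_inner)
  finally obtain \<phi> where "v $ 1 / norm v = cos \<phi>" "v $ 2 / norm v = sin \<phi>"
    using sincos_total_2pi by metis
  then have "cos \<phi> = v $ 1 / norm v" "sin \<phi> = v $ 2 / norm v" by simp_all
  then have "v = norm v *\<^sub>R dir \<phi>"
    using assms by (simp add: dir_def vec_eq_iff forall_2)
  then show ?thesis using that[of "norm v" \<phi>] assms by simp
qed

lemma dir_in_window:
  obtains \<psi> where "\<theta> - 2 * pi < \<psi>" "\<psi> \<le> \<theta>" "dir \<psi> = dir \<phi>"
proof
  define k where "k = \<lfloor>(\<theta> - \<phi>) / (2 * pi)\<rfloor>"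
  have "k \<le> (\<theta> - \<phi>) / (2 * pi)" "(\<theta> - \<phi>) / (2 * pi) < k + 1"
    unfolding k_def by linarith+
  then show "\<theta> - 2 * pi < \<phi> + 2 * pi * k" "\<phi> + 2 * pi * k \<le> \<theta>"
    by (auto simp: field_simps)
  show "dir (\<phi> + 2 * pi * k) = dir \<phi>"
    by (simp add: dir_def sin_add cos_add mult.assoc[symmetric])
qed

text \<open>If \<open>dir \<phi>\<close> separates \<open>P\<close> from \<open>Q\<close>, then turning from \<open>\<phi>\<close> through a full circle the
  maximizer switches from \<open>P\<close> to \<open>Q\<close> once and back once.\<close>

lemma separated_no_alternation:
  assumes sep: "\<And>p q. p \<in> P \<Longrightarrow> q \<in> Q \<Longrightarrow> 0 < dir \<phi> \<bullet> (p - q)"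
    and t: "\<phi> \<le> t1" "t1 < t2" "t2 < t3" "t3 < \<phi> + 2 * pi"
    and q1: "q1 \<in> Q" "\<And>p. p \<in> P \<Longrightarrow> dir t1 \<bullet> p \<le> dir t1 \<bullet> q1"
    and p2: "p2 \<in> P" "\<And>q. q \<in> Q \<Longrightarrow> dir t2 \<bullet> q \<le> dir t2 \<bullet> p2"
    and q3: "q3 \<in> Q" "\<And>p. p \<in> P \<Longrightarrow> dir t3 \<bullet> p \<le> dir t3 \<bullet> q3"
  shows False
proof -
  have signs: "dir t1 \<bullet> (p2 - q1) \<le> 0" "0 \<le> dir t2 \<bullet> (p2 - q1)" "0 < dir \<phi> \<bullet> (p2 - q1)"
      "dir t3 \<bullet> (p2 - q3) \<le> 0" "0 \<le> dir t2 \<bullet> (p2 - q3)" "0 < dir \<phi> \<bullet> (p2 - q3)"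
    using sep q1 p2 q3 by (auto simp: inner_diff_right)
  \<comment> \<open>Before half a turn \<open>dir t1\<close> is a nonnegative combination of
    \<open>dir \<phi>\<close> and \<open>dir t2\<close>, both of which favour \<open>p2\<close> over
    \<open>q1\<close>. After half a turn the same argument applies to \<open>t3\<close>, between
    \<open>t2\<close> and \<open>\<phi> + 2 * pi\<close>, and \<open>q3\<close>.\<close>
  consider "t2 < \<phi> + pi" | "t2 = \<phi> + pi" | "\<phi> + pi < t2" by linarith
  then show False
  proof cases
    case 1
    have "0 < sin (t2 - \<phi>)" "0 < sin (t2 - t1)" "0 \<le> sin (t1 - \<phi>)"
      using t 1 by (auto intro: sin_gt_zero sin_ge_zero)
    then have "sin (t2 - \<phi>) * (dir t1 \<bullet> (p2 - q1)) \<le> 0"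
        "0 < sin (t2 - t1) * (dir \<phi> \<bullet> (p2 - q1)) + sin (t1 - \<phi>) * (dir t2 \<bullet> (p2 - q1))"
      using signs by (auto intro: mult_nonneg_nonpos add_pos_nonneg)
    then show False using dir_combination[of t2 \<phi> t1 "p2 - q1"] by linarith
  next
    case 2
    then show False using signs by (simp add: dir_add_pi)
  next
    case 3
    let ?\<phi> = "\<phi> + 2 * pi"
    have "0 < sin (?\<phi> - t2)" "0 < sin (t3 - t2)" "0 < sin (?\<phi> - t3)"
      using t 3 by (auto intro: sin_gt_zero)
    then have "sin (?\<phi> - t2) * (dir t3 \<bullet> (p2 - q3)) \<le> 0"
        "0 < sin (?\<phi> - t3) * (dir t2 \<bullet> (p2 - q3)) + sin (t3 - t2) * (dir ?\<phi> \<bullet> (p2 - q3))"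
      using signs by (auto intro: mult_nonneg_nonpos add_nonneg_pos)
    then show False using dir_combination[of ?\<phi> t2 t3 "p2 - q3"] by linarith
  qed
qed

text \<open>Disjoint segments would be strictly separated by a line, and then the maximizers among
  their endpoints could not alternate.\<close>

lemma alternating_maximizers_cross:
  assumes \<theta>: "\<theta>1 < \<theta>2" "\<theta>2 < \<theta>3" "\<theta>3 < \<theta>4" "\<theta>4 < \<theta>1 + 2 * pi"
    and p1: "dir \<theta>1 \<bullet> q2 \<le> dir \<theta>1 \<bullet> p1" "dir \<theta>1 \<bullet> q4 \<le> dir \<theta>1 \<bullet> p1"
    and q2: "dir \<theta>2 \<bullet> p1 \<le> dir \<theta>2 \<bullet> q2" "dir \<theta>2 \<bullet> p3 \<le> dir \<theta>2 \<bullet> q2"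
    and p3: "dir \<theta>3 \<bullet> q2 \<le> dir \<theta>3 \<bullet> p3" "dir \<theta>3 \<bullet> q4 \<le> dir \<theta>3 \<bullet> p3"
    and q4: "dir \<theta>4 \<bullet> p1 \<le> dir \<theta>4 \<bullet> q4" "dir \<theta>4 \<bullet> p3 \<le> dir \<theta>4 \<bullet> q4"
  shows "closed_segment p1 p3 \<inter> closed_segment q2 q4 \<noteq> {}"
proof
  assume "closed_segment p1 p3 \<inter> closed_segment q2 q4 = {}"
  then have "closed_segment q2 q4 \<inter> closed_segment p1 p3 = {}" by blast
  then obtain v c where v: "\<forall>x\<in>closed_segment q2 q4. v \<bullet> x < c" "\<forall>x\<in>closed_segment p1 p3. c < v \<bullet> x"
    using separating_hyperplane_compact_closed[of "closed_segment q2 q4" "closed_segment p1 p3"]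
    by (auto intro: compact_imp_closed)
  then have "v \<noteq> 0" by (metis ends_in_segment(1) inner_zero_left order.asym)
  then obtain r \<phi>0 where r: "0 < r" "v = r *\<^sub>R dir \<phi>0" by (rule polar_decomposition)
  \<comment> \<open>With this window, three of the four angles, possibly after a full turn, follow
    \<open>\<phi>\<close> within one turn and have maximizers from \<open>q\<close>,
    \<open>p\<close>, \<open>q\<close> in this order.\<close>
  obtain \<phi> where \<phi>: "\<theta>4 - 2 * pi < \<phi>" "\<phi> \<le> \<theta>4" "dir \<phi> = dir \<phi>0"
    by (rule dir_in_window)
  have sep: "0 < dir \<phi> \<bullet> (p - q)" if "p \<in> {p1, p3}" "q \<in> {q2, q4}" for p q
  proof -
    have "p \<in> closed_segment p1 p3" "q \<in> closed_segment q2 q4" using that by auto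
    then have "0 < v \<bullet> (p - q)" using v by (fastforce simp: inner_diff_right)
    then show ?thesis using r \<phi>(3) by (simp add: zero_less_mult_iff)
  qed
  note no = separated_no_alternation[of "{p1, p3}" "{q2, q4}", OF sep]
  consider "\<phi> \<le> \<theta>2" | "\<theta>2 < \<phi>" by linarith
  then show False
  proof cases
    case 1
    then show False using no[of \<theta>2 \<theta>3 \<theta>4 q2 p3 q4] \<theta> \<phi> q2 p3 q4 by auto
  next
    case 2
    then show False
      using no[of \<theta>4 "\<theta>1 + 2 * pi" "\<theta>2 + 2 * pi" q4 p1 q2] \<theta> \<phi> q2 p1 q4 by auto
  qed
qed

section \<open>Planar coordinates and common frontier points\<close>

definition cross2 :: "plane \<Rightarrow> plane \<Rightarrow> real" where
  "cross2 u v = u $ 1 * v $ 2 - u $ 2 * v $ 1"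

lemma cross2_simps:
  "cross2 (u + w) v = cross2 u v + cross2 w v" "cross2 u (v + w) = cross2 u v + cross2 u w"
  "cross2 (c *\<^sub>R u) v = c * cross2 u v" "cross2 u (c *\<^sub>R v) = c * cross2 u v"
  "cross2 (- u) v = - cross2 u v" "cross2 u (- v) = - cross2 u v" "cross2 u u = 0"
  by (simp_all add: cross2_def algebra_simps)

text \<open>Cramer's rule in the basis \<open>u\<close>, \<open>v\<close>.\<close>

lemma cross2_expand:
  assumes "cross2 u v \<noteq> 0"
  shows "w = (cross2 w v / cross2 u v) *\<^sub>R u + (cross2 u w / cross2 u v) *\<^sub>R v"
proof -
  have "cross2 u v *\<^sub>R w = cross2 w v *\<^sub>R u + cross2 u w *\<^sub>R v"
    by (simp add: cross2_def vec_eq_iff forall_2 algebra_simps)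
  then have "(1 / cross2 u v) *\<^sub>R (cross2 u v *\<^sub>R w) =
      (1 / cross2 u v) *\<^sub>R (cross2 w v *\<^sub>R u + cross2 u w *\<^sub>R v)" by simp
  then show ?thesis using assms by (simp add: scaleR_add_right)
qed

lemma cross2_eq_0:
  assumes "cross2 u v = 0" "u \<noteq> 0"
  obtains c where "v = c *\<^sub>R u"
proof (cases "u $ 1 = 0")
  case True
  then have "u $ 2 \<noteq> 0" using assms(2) by (simp add: vec_eq_iff forall_2)
  then have "v = (v $ 2 / u $ 2) *\<^sub>R u"
    using assms(1) True by (simp add: vec_eq_iff forall_2 cross2_def)
  then show ?thesis by (rule that)
next
  case False
  then have "v = (v $ 1 / u $ 1) *\<^sub>R u"
    using assms(1) by (simp add: vec_eq_iff forall_2 cross2_def field_simps)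
  then show ?thesis by (rule that)
qed

lemma convex_ray_mem:
  fixes x e :: "'a::real_vector"
  assumes "convex S" "x \<in> S" "x + d *\<^sub>R e \<in> S" "0 \<le> c" "c \<le> d"
  shows "x + c *\<^sub>R e \<in> S"
proof (cases "d = 0")
  case False
  then have "0 < d" using assms by linarith
  then have "(1 - c / d) *\<^sub>R x + (c / d) *\<^sub>R (x + d *\<^sub>R e) \<in> S"
    using assms by (intro convexD) auto
  then show ?thesis using False by (simp add: algebra_simps)
qed (use assms in auto)

lemma convex_ray_interior:
  fixes x e :: "'a::euclidean_space"
  assumes "convex S" "x \<in> interior S" "x + d *\<^sub>R e \<in> S" "0 \<le> c" "c < d"
  shows "x + c *\<^sub>R e \<in> interior S"
proof -
  have "x + d *\<^sub>R e - (1 - c / d) *\<^sub>R (x + d *\<^sub>R e - x) \<in> interior S"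
    using assms by (intro mem_interior_convex_shrink) auto
  then show ?thesis using assms by (simp add: algebra_simps)
qed

text \<open>The ray leaves \<open>D\<close> before reaching \<open>x + e\<close>, so any of its
  points in \<open>D\<close> comes strictly before a point of \<open>C\<close> and is still interior
  to \<open>C\<close>.\<close>

lemma ray_exit_interior:
  fixes x e :: "'a::euclidean_space"
  assumes "convex C" "convex D" "x \<in> interior C" "x \<in> D"
    and "x + e \<in> C" "x + e \<notin> D" "x + d *\<^sub>R e \<in> D" "0 \<le> d"
  shows "x + d *\<^sub>R e \<in> interior C"
proof -
  have "d < 1" using convex_ray_mem[of D x d e 1] assms by force
  then show ?thesis using convex_ray_interior[of C x 1 e d] assms by simp
qed

text \<open>Both frontiers cover the part of the frontier of \<open>C \<inter> D\<close> inside the cone, and each misses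
  one of the two bounding rays; project radially to \<open>[0, 1]\<close> and use connectedness.\<close>

lemma common_frontier_in_cone:
  fixes C D :: "plane set"
  assumes C: "compact C" "convex C" and D: "compact D" "convex D"
    and x: "x \<in> interior C" "x \<in> interior D"
    and p: "x + u \<in> C" "x + u \<notin> D" and q: "x + v \<in> D" "x + v \<notin> C"
    and uv: "cross2 u v \<noteq> 0"
  shows "\<exists>\<alpha>>0. \<exists>\<beta>>0. x + \<alpha> *\<^sub>R u + \<beta> *\<^sub>R v \<in> frontier C \<inter> frontier D"
proof -
  \<comment> \<open>\<open>al\<close> and \<open>be\<close> are the coordinates with origin
    \<open>x\<close> and basis \<open>u\<close>, \<open>v\<close>; the closed cone is where both are
    nonnegative.\<close>
  define al where "al y = cross2 (y - x) v / cross2 u v" for y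
  define be where "be y = cross2 u (y - x) / cross2 u v" for y
  have expand: "x + (al y *\<^sub>R u + be y *\<^sub>R v) = y" for y
    using cross2_expand[OF uv, of "y - x"] by (simp add: al_def be_def diff_eq_eq add.commute)
  have coord: "al (x + (s *\<^sub>R u + t *\<^sub>R v)) = s" "be (x + (s *\<^sub>R u + t *\<^sub>R v)) = t" for s t
    using uv by (simp_all add: al_def be_def cross2_simps)
  have cont: "continuous_on S al" "continuous_on S be" for S
    unfolding al_def be_def cross2_def
    by (intro continuous_intros; use uv in \<open>simp add: cross2_def\<close>)+
  define E where "E = C \<inter> D"
  have E: "compact E" "convex E" "x \<in> interior E"
    using C D x by (auto simp: E_def compact_Int convex_Int interior_Int)
  define K where "K = frontier E \<inter> {y. 0 \<le> al y} \<inter> {y. 0 \<le> be y}"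
  have "closed {y. 0 \<le> al y}" "closed {y. 0 \<le> be y}"
    using cont by (auto intro: closed_Collect_le continuous_on_const)
  then have K: "compact K" unfolding K_def
    using E(1) compact_frontier by (intro compact_Int_closed) auto
  have K_E: "y \<in> E" "y \<in> C" "y \<in> D" "y \<notin> interior E" if "y \<in> K" for y
  proof -
    have "y \<in> frontier E" using that by (simp add: K_def)
    moreover have "frontier E \<subseteq> E"
      using E(1) by (intro frontier_subset_closed compact_imp_closed)
    ultimately show "y \<in> E" "y \<in> C" "y \<in> D" "y \<notin> interior E"
      by (auto simp: E_def frontier_def)
  qed
  have pos: "0 < al y + be y" if "y \<in> K" for y
  proof (rule ccontr)
    assume "\<not> 0 < al y + be y"
    then have "al y = 0" "be y = 0" using that by (auto simp: K_def)
    then have "y = x" using expand[of y] by simp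
    then show False using K_E[OF that] E(3) by simp
  qed
  \<comment> \<open>For \<open>y\<close> in \<open>K\<close>, \<open>proj y = t\<close> means that
    \<open>y\<close> is on the ray from \<open>x\<close> in the direction that divides the segment
    from \<open>u\<close> to \<open>v\<close> in the ratio \<open>t : 1 - t\<close>.\<close>
  define proj where "proj y = be y / (al y + be y)" for y
  have cproj: "continuous_on K proj"
    unfolding proj_def using pos by (intro continuous_intros cont) force
  have cover: "\<exists>y\<in>K. proj y = t \<and> (y \<in> frontier C \<or> y \<in> frontier D)" if "t \<in> {0..1}" for t
  proof -
    let ?z = "(1 - t) *\<^sub>R u + t *\<^sub>R v"
    have "?z \<noteq> 0"
    proof
      assume "?z = 0"
      then have "cross2 ?z v = 0" "cross2 u ?z = 0" by (simp_all add: cross2_def)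
      then show False using uv by (simp add: cross2_simps)
    qed
    then obtain d where d: "0 < d" "x + d *\<^sub>R ?z \<in> frontier E"
      using ray_to_frontier[of E x ?z] E compact_imp_bounded by blast
    let ?y = "x + d *\<^sub>R ?z"
    have y: "?y = x + ((d * (1 - t)) *\<^sub>R u + (d * t) *\<^sub>R v)" by (simp add: scaleR_add_right)
    have ab: "al ?y = d * (1 - t)" "be ?y = d * t" unfolding y coord by auto
    then have "?y \<in> K" using d that by (auto simp: K_def)
    moreover have "proj ?y = t"
    proof -
      have "d * (1 - t) + d * t = d" by (simp add: algebra_simps)
      then show ?thesis unfolding proj_def ab using d(1) by simp
    qed
    moreover have "?y \<in> frontier C \<or> ?y \<in> frontier D"
      using d(2) frontier_Int_subset[of C D] by (auto simp: E_def)
    ultimately show ?thesis by blast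
  qed
  \<comment> \<open>Along \<open>u\<close> the body \<open>D\<close> ends before \<open>C\<close>,
    so the frontier of \<open>C\<close> has no point of \<open>K\<close> on that bounding ray;
    \<open>endD\<close> is the same along \<open>v\<close>.\<close>
  have endC: "0 < be y" if "y \<in> K" "y \<in> frontier C" for y
  proof (rule ccontr)
    assume "\<not> 0 < be y"
    then have "be y = 0" "0 \<le> al y" using that by (auto simp: K_def)
    moreover from this have "x + al y *\<^sub>R u = y" using expand[of y] by simp
    ultimately have "y \<in> interior C"
      using ray_exit_interior[of C D x u "al y"] C D x p K_E[OF that(1)]
        interior_subset[of D] by auto
    then show False using that by (simp add: frontier_def)
  qed
  have endD: "0 < al y" if "y \<in> K" "y \<in> frontier D" for y
  proof (rule ccontr)
    assume "\<not> 0 < al y"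
    then have "al y = 0" "0 \<le> be y" using that by (auto simp: K_def)
    moreover from this have "x + be y *\<^sub>R v = y" using expand[of y] by simp
    ultimately have "y \<in> interior D"
      using ray_exit_interior[of D C x v "be y"] C D x q K_E[OF that(1)]
        interior_subset[of C] by auto
    then show False using that by (simp add: frontier_def)
  qed
  let ?A = "proj ` (K \<inter> frontier C)" and ?B = "proj ` (K \<inter> frontier D)"
  have "closed ?A" "closed ?B"
    using K cproj
    by (auto intro!: compact_imp_closed compact_continuous_image compact_Int_closed
        intro: continuous_on_subset)
  moreover have "{0..1} \<subseteq> ?A \<union> ?B" using cover by blast
  moreover have "?B \<inter> {0..1} \<noteq> {}"
  proof -
    obtain y where y: "y \<in> K" "proj y = 0" "y \<in> frontier C \<or> y \<in> frontier D"
      using cover[of 0] by auto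
    then have "be y = 0" using pos[of y] by (auto simp: proj_def)
    then have "y \<in> frontier D" using y endC[of y] by auto
    then show ?thesis using y by force
  qed
  moreover have "?A \<inter> {0..1} \<noteq> {}"
  proof -
    obtain y where y: "y \<in> K" "proj y = 1" "y \<in> frontier C \<or> y \<in> frontier D"
      using cover[of 1] by auto
    then have "al y = 0" using pos[of y] by (auto simp: proj_def field_simps)
    then have "y \<in> frontier C" using y endD[of y] by auto
    then show ?thesis using y by force
  qed
  ultimately have "?A \<inter> ?B \<inter> {0..1} \<noteq> {}"
    using connected_closedD[of "{0..1}" ?A ?B] connected_Icc[of "0::real" 1] by blast
  then obtain y z where y: "y \<in> K" "y \<in> frontier C" and z: "z \<in> K" "z \<in> frontier D"
      and eq: "proj y = proj z"
    by force
  define w where "w = (1 - proj y) *\<^sub>R u + proj y *\<^sub>R v"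
  have ray: "x + (al y' + be y') *\<^sub>R w = y'" if "y' \<in> K" "proj y' = proj y" for y'
  proof -
    have "(al y' + be y') * (1 - proj y') = al y'" "(al y' + be y') * proj y' = be y'"
      using pos[OF that(1)] by (auto simp: proj_def field_simps)
    then have "(al y' + be y') *\<^sub>R w = al y' *\<^sub>R u + be y' *\<^sub>R v"
      by (simp add: w_def scaleR_add_right flip: that(2))
    then show ?thesis by (simp add: expand)
  qed
  \<comment> \<open>A ray from an interior point meets the frontier of the convex set
    \<open>E\<close> only once.\<close>
  have "al y + be y = al z + be z"
    using convex_ray_interior[OF E(2,3), of "al z + be z" w "al y + be y"]
      convex_ray_interior[OF E(2,3), of "al y + be y" w "al z + be z"]
      ray[of y] ray[of z] eq y z K_E pos
    by (metis less_imp_le linorder_neqE_linordered_idom)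
  then have "y = z" using ray[of y] ray[of z] eq y z by metis
  then have "0 < al y" "0 < be y" "y \<in> frontier C \<inter> frontier D" using endC endD y z by auto
  then show ?thesis using expand[of y] by (metis add.assoc)
qed

text \<open>For \<open>c \<ge> 0\<close> the nearer to \<open>x\<close> of the two points on the ray
  would lie in both sets by convexity.\<close>

lemma convex_not_positive_multiple:
  fixes x e :: "'a::real_vector"
  assumes "convex C" "convex D" "x \<in> C" "x \<in> D"
    and "x + e \<in> C" "x + e \<notin> D" "x + c *\<^sub>R e \<in> D" "x + c *\<^sub>R e \<notin> C"
  shows "c < 0"
proof (rule ccontr)
  assume "\<not> c < 0"
  then show False
    using convex_ray_mem[of C x 1 e c] convex_ray_mem[of D x c e 1] assms
    by (cases "c \<le> 1") auto
qed

text \<open>Two lines through \<open>x\<close> cut the plane into four cones, each bounded by a ray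
  towards a point of \<open>C - D\<close> and a ray towards a point of \<open>D - C\<close>. Each
  open cone contains a common frontier point, and the signs of the coordinates tell the four points
  apart.\<close>

lemma four_common_frontier_points:
  fixes C D :: "plane set"
  assumes C: "compact C" "convex C" and D: "compact D" "convex D"
    and x: "x \<in> interior C" "x \<in> interior D" "0 < \<kappa>" "0 < \<mu>"
    and p: "x + u \<in> C - D" "x + (- \<kappa>) *\<^sub>R u \<in> C - D"
    and q: "x + v \<in> D - C" "x + (- \<mu>) *\<^sub>R v \<in> D - C"
  shows "\<exists>Y\<subseteq>frontier C \<inter> frontier D. finite Y \<and> card Y = 4"
proof -
  have xC: "x \<in> C" "x \<in> D" using x interior_subset by auto
  have "u \<noteq> 0" using p xC by auto
  \<comment> \<open>If \<open>v\<close> were \<open>c\<close> times \<open>u\<close>, comparison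
    with \<open>u\<close> would force \<open>c < 0\<close>, and comparison with the opposite point
    of \<open>C - D\<close> would force \<open>0 < c\<close>.\<close>
  have uv: "cross2 u v \<noteq> 0"
  proof
    assume "cross2 u v = 0"
    then obtain c where c: "v = c *\<^sub>R u" using \<open>u \<noteq> 0\<close> by (rule cross2_eq_0)
    have "c < 0" using convex_not_positive_multiple[OF C(2) D(2) xC, of u c] p q c by auto
    moreover have "v = (- c / \<kappa>) *\<^sub>R ((- \<kappa>) *\<^sub>R u)" using x c by simp
    then have "- c / \<kappa> < 0"
      using convex_not_positive_multiple[OF C(2) D(2) xC, of "(- \<kappa>) *\<^sub>R u" "- c / \<kappa>"] p q
      by (metis DiffD1 DiffD2)
    then have "0 < c" using x by (simp add: field_simps)
    ultimately show False by simp
  qed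
  define al where "al y = cross2 (y - x) v / cross2 u v" for y
  define be where "be y = cross2 u (y - x) / cross2 u v" for y
  have coord: "al (x + s *\<^sub>R u + t *\<^sub>R v) = s" "be (x + s *\<^sub>R u + t *\<^sub>R v) = t" for s t
    using uv by (simp_all add: al_def be_def cross2_simps add.assoc)
  note cone = common_frontier_in_cone[OF C D x(1,2)]
  have uv': "cross2 ((- \<kappa>) *\<^sub>R u) v \<noteq> 0" "cross2 u ((- \<mu>) *\<^sub>R v) \<noteq> 0"
      "cross2 ((- \<kappa>) *\<^sub>R u) ((- \<mu>) *\<^sub>R v) \<noteq> 0"
    using uv x by (simp_all only: cross2_simps) auto
  have "\<exists>y\<in>frontier C \<inter> frontier D. 0 < al y \<and> 0 < be y"
    using cone[of u v] p q uv coord by (metis DiffD1 DiffD2)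
  moreover have "\<exists>y\<in>frontier C \<inter> frontier D. al y < 0 \<and> 0 < be y"
  proof -
    obtain s t where st: "0 < s" "0 < t"
        "x + s *\<^sub>R (- \<kappa>) *\<^sub>R u + t *\<^sub>R v \<in> frontier C \<inter> frontier D"
      using cone[OF _ _ _ _ uv'(1)] p q by blast
    then show ?thesis using coord[of "s * - \<kappa>" t] x
      by (intro bexI[OF _ st(3)]) (simp add: mult_pos_neg)
  qed
  moreover have "\<exists>y\<in>frontier C \<inter> frontier D. 0 < al y \<and> be y < 0"
  proof -
    obtain s t where st: "0 < s" "0 < t"
        "x + s *\<^sub>R u + t *\<^sub>R (- \<mu>) *\<^sub>R v \<in> frontier C \<inter> frontier D"
      using cone[OF _ _ _ _ uv'(2)] p q by blast
    then show ?thesis using coord[of s "t * - \<mu>"] x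
      by (intro bexI[OF _ st(3)]) (simp add: mult_pos_neg)
  qed
  moreover have "\<exists>y\<in>frontier C \<inter> frontier D. al y < 0 \<and> be y < 0"
  proof -
    obtain s t where st: "0 < s" "0 < t"
        "x + s *\<^sub>R (- \<kappa>) *\<^sub>R u + t *\<^sub>R (- \<mu>) *\<^sub>R v \<in> frontier C \<inter> frontier D"
      using cone[OF _ _ _ _ uv'(3)] p q by blast
    then show ?thesis using coord[of "s * - \<kappa>" "t * - \<mu>"] x
      by (intro bexI[OF _ st(3)]) (simp add: mult_pos_neg)
  qed
  ultimately obtain y1 y2 y3 y4 where y: "{y1, y2, y3, y4} \<subseteq> frontier C \<inter> frontier D"
    and sg: "0 < al y1" "0 < be y1" "al y2 < 0" "0 < be y2" "0 < al y3" "be y3 < 0"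
      "al y4 < 0" "be y4 < 0"
    by (metis empty_subsetI insert_subset)
  have "y1 \<noteq> y2" "y1 \<noteq> y3" "y1 \<noteq> y4" "y2 \<noteq> y3" "y2 \<noteq> y4" "y3 \<noteq> y4"
    using sg by (metis order.asym)+
  then have "card {y1, y2, y3, y4} = 4" by simp
  then show ?thesis using y by (intro exI[of _ "{y1, y2, y3, y4}"]) auto
qed

lemma closed_segment_opposite:
  fixes p p' x :: "'a::real_vector"
  assumes "x \<in> closed_segment p p'" "x \<noteq> p" "x \<noteq> p'"
  obtains \<kappa> where "0 < \<kappa>" "p' = x + (- \<kappa>) *\<^sub>R (p - x)"
proof -
  obtain s where s: "0 \<le> s" "s \<le> 1" "x = (1 - s) *\<^sub>R p + s *\<^sub>R p'"
    using assms(1) by (auto simp: in_segment)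
  then have s': "0 < s" "s < 1" using assms(2,3) by (auto simp: less_le)
  have "s *\<^sub>R (p' - x) = (- (1 - s)) *\<^sub>R (p - x)" using s(3) by (simp add: algebra_simps)
  then have "(1 / s) *\<^sub>R (s *\<^sub>R (p' - x)) = (1 / s) *\<^sub>R ((- (1 - s)) *\<^sub>R (p - x))" by simp
  then have "p' - x = (1 / s * - (1 - s)) *\<^sub>R (p - x)"
    unfolding scaleR_scaleR using s' by simp
  moreover have "1 / s * - (1 - s) = - ((1 - s) / s)" by (simp add: minus_divide_left)
  ultimately have "p' - x = (- ((1 - s) / s)) *\<^sub>R (p - x)" by metis
  then have "p' = x + (- ((1 - s) / s)) *\<^sub>R (p - x)" by (metis add.commute diff_add_cancel)
  then show ?thesis using that[of "(1 - s) / s"] s' by simp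
qed

text \<open>The crossing point lies in both bodies but possibly on a frontier. A small homothety
  keeps each endpoint outside the other, closed, body and preserves the ratios on both segments, so
  \<open>four_common_frontier_points\<close> applies to the images.\<close>

lemma crossing_segments_frontier:
  fixes C D :: "plane set"
  assumes C: "compact C" "convex C" and D: "compact D" "convex D"
    and int: "interior C \<inter> interior D \<noteq> {}"
    and p: "p1 \<in> C - D" "p3 \<in> C - D" and q: "q2 \<in> D - C" "q4 \<in> D - C"
    and cross: "closed_segment p1 p3 \<inter> closed_segment q2 q4 \<noteq> {}"
  shows "\<exists>Y\<subseteq>frontier C \<inter> frontier D. finite Y \<and> card Y = 4"
proof -
  obtain o' where o: "o' \<in> interior C" "o' \<in> interior D" using int by blast
  obtain x where x: "x \<in> closed_segment p1 p3" "x \<in> closed_segment q2 q4" using cross by blast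
  \<comment> \<open>A small homothety towards \<open>o'\<close> moves the crossing point into both interiors.\<close>
  define H where "H e z = z - e *\<^sub>R (z - o')" for e z
  have leave: "\<forall>\<^sub>F e in at_right 0. H e z \<notin> S" if "closed S" "z \<notin> S" for S z
  proof -
    have "((\<lambda>e. z - e *\<^sub>R (z - o')) \<longlongrightarrow> z - 0 *\<^sub>R (z - o')) (at_right 0)"
      by (intro tendsto_intros)
    then have "\<forall>\<^sub>F e in at_right 0. H e z \<in> - S"
      unfolding H_def using that by (intro topological_tendstoD) (auto simp: open_Compl)
    then show ?thesis by simp
  qed
  have "\<forall>\<^sub>F e in at_right (0::real). e \<in> {0<..<1}"
    by (intro eventually_at_right_real) auto
  then have "\<forall>\<^sub>F e in at_right 0. e \<in> {0<..<1} \<and> H e p1 \<notin> D \<and> H e p3 \<notin> D \<and> H e q2 \<notin> C \<and> H e q4 \<notin> C"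
    using p q C D by (intro eventually_conj leave compact_imp_closed) auto
  then obtain e where e: "0 < e" "e < 1" "H e p1 \<notin> D" "H e p3 \<notin> D" "H e q2 \<notin> C" "H e q4 \<notin> C"
    using eventually_happens'[OF trivial_limit_at_right_real] by (metis (no_types, lifting) greaterThanLessThan_iff)
  have shrink: "H e z \<in> interior S" if "convex S" "o' \<in> interior S" "z \<in> S" for S z
    unfolding H_def using mem_interior_convex_shrink[OF that] e by simp
  have xCD: "x \<in> C" "x \<in> D"
    using x p q C D closed_segment_subset by blast+
  have Hx: "H e x \<in> interior C" "H e x \<in> interior D" using shrink C D o xCD by auto
  have HC: "H e p1 \<in> C" "H e p3 \<in> C" "H e q2 \<in> D" "H e q4 \<in> D"
    using shrink C D o p q interior_subset by (meson DiffD1 subsetD)+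
  have seg: "\<exists>\<kappa>>0. H e b = H e x + (- \<kappa>) *\<^sub>R (H e a - H e x)"
    if ab: "x \<in> closed_segment a b" "x \<noteq> a" "x \<noteq> b" for a b
  proof -
    obtain \<kappa> where "0 < \<kappa>" and b: "b = x + (- \<kappa>) *\<^sub>R (a - x)"
      using closed_segment_opposite[OF ab] by blast
    moreover have "H e b = H e x + (- \<kappa>) *\<^sub>R (H e a - H e x)"
      unfolding H_def b by (simp add: algebra_simps)
    ultimately show ?thesis by blast
  qed
  have "x \<noteq> p1" "x \<noteq> p3" "x \<noteq> q2" "x \<noteq> q4" using xCD p q by auto
  then obtain \<kappa> \<mu> where \<kappa>: "0 < \<kappa>" "H e p3 = H e x + (- \<kappa>) *\<^sub>R (H e p1 - H e x)"
      and \<mu>: "0 < \<mu>" "H e q4 = H e x + (- \<mu>) *\<^sub>R (H e q2 - H e x)"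
    using seg x by meson
  show ?thesis
    using four_common_frontier_points[OF C D Hx \<kappa>(1) \<mu>(1), of "H e p1 - H e x" "H e q2 - H e x"]
      \<kappa> \<mu> HC e by simp
qed

section \<open>Support functions\<close>

definition supp :: "plane set \<Rightarrow> real \<Rightarrow> real" where
  "supp C \<theta> = Sup ((\<lambda>x. dir \<theta> \<bullet> x) ` C)"

lemma supp_attained:
  assumes "compact C" "C \<noteq> {}"
  obtains x where "x \<in> C" "dir \<theta> \<bullet> x = supp C \<theta>"
proof -
  have "continuous_on C (\<lambda>x. dir \<theta> \<bullet> x)" by (intro continuous_intros)
  then obtain x where "x \<in> C" "\<forall>y\<in>C. dir \<theta> \<bullet> y \<le> dir \<theta> \<bullet> x"
    using continuous_attains_sup[OF assms] by blast
  then show ?thesis using that[of x] unfolding supp_def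
    by (metis (no_types, lifting) cSup_eq_maximum image_iff)
qed

lemma supp_ge:
  assumes "compact C" "x \<in> C"
  shows "dir \<theta> \<bullet> x \<le> supp C \<theta>"
proof -
  have "compact ((\<lambda>x. dir \<theta> \<bullet> x) ` C)"
    using assms by (intro compact_continuous_image continuous_intros)
  then show ?thesis unfolding supp_def
    using assms by (intro cSup_upper bounded_imp_bdd_above compact_imp_bounded) auto
qed

lemma supp_add_2pi [simp]: "supp C (\<theta> + 2 * pi) = supp C \<theta>"
  by (simp add: supp_def)

text \<open>The support value changes by at most a norm bound of \<open>C\<close> times the change
  of the unit vector.\<close>

lemma continuous_on_supp:
  assumes "compact C" "C \<noteq> {}"
  shows "continuous_on S (supp C)"
proof -
  obtain M where M: "\<And>x. x \<in> C \<Longrightarrow> norm x \<le> M" "0 < M"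
    using compact_imp_bounded[OF assms(1)] by (auto simp: bounded_pos)
  have half: "supp C a - supp C b \<le> M * dist (dir a) (dir b)" for a b
  proof -
    obtain x where x: "x \<in> C" "dir a \<bullet> x = supp C a" using supp_attained[OF assms] by blast
    have "supp C a - supp C b \<le> (dir a - dir b) \<bullet> x"
      using supp_ge[OF assms(1) x(1), of b] x(2) by (simp add: inner_diff_left)
    also have "\<dots> \<le> norm (dir a - dir b) * norm x" by (rule norm_cauchy_schwarz)
    also have "\<dots> \<le> dist (dir a) (dir b) * M"
      using M(1)[OF x(1)] by (simp add: dist_norm mult_left_mono)
    finally show ?thesis by (simp add: mult.commute)
  qed
  have bound: "dist (supp C a) (supp C b) \<le> M * dist (dir a) (dir b)" for a b
    using half[of a b] half[of b a] by (simp add: dist_real_def dist_commute abs_le_iff)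
  show ?thesis unfolding continuous_on_def
  proof
    fix a assume "a \<in> S"
    then have "(dir \<longlongrightarrow> dir a) (at a within S)"
      using continuous_on_dir[of S] by (simp add: continuous_on_def)
    then have "((\<lambda>t. M * dist (dir t) (dir a)) \<longlongrightarrow> M * 0) (at a within S)"
      by (intro tendsto_intros tendsto_dist_iff[THEN iffD1])
    then show "(supp C \<longlongrightarrow> supp C a) (at a within S)"
      using bound unfolding tendsto_dist_iff[of "supp C"]
      by (intro tendsto_sandwich[of "\<lambda>_. 0" "\<lambda>t. dist (supp C t) (supp C a)"]) auto
  qed
qed

lemma tangent_line_supp:
  assumes "compact C" "C \<noteq> {}"
  shows "tangent_line {x. dir \<theta> \<bullet> x = supp C \<theta>} C"
  unfolding tangent_line_def
proof (intro exI conjI)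
  show "{x. dir \<theta> \<bullet> x = supp C \<theta>} \<inter> C \<noteq> {}" using supp_attained[OF assms] by blast
  show "\<forall>x\<in>C. dir \<theta> \<bullet> x \<le> supp C \<theta>" using supp_ge assms by blast
qed auto

text \<open>The maximizers lie outside the other body and alternate, so their segments cross and the
  frontiers share four points. The inequalities are weak so that ties of the support functions are
  covered too.\<close>

lemma supp_no_alternation:
  assumes C: "convex_body C" and D: "convex_body D"
    and noncr: "finite (frontier C \<inter> frontier D)" "card (frontier C \<inter> frontier D) \<le> 2"
    and tang: "\<not> (\<exists>L. tangent_line L C \<and> tangent_line L D \<and> L \<inter> (C \<inter> D) \<noteq> {})"
    and \<theta>: "\<theta>1 < \<theta>2" "\<theta>2 < \<theta>3" "\<theta>3 < \<theta>4" "\<theta>4 < \<theta>1 + 2 * pi"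
    and le: "supp D \<theta>1 \<le> supp C \<theta>1" "supp C \<theta>2 \<le> supp D \<theta>2"
      "supp D \<theta>3 \<le> supp C \<theta>3" "supp C \<theta>4 \<le> supp D \<theta>4"
  shows False
proof -
  have cpt: "compact C" "convex C" "C \<noteq> {}" "compact D" "convex D" "D \<noteq> {}"
      "interior C \<noteq> {}" "interior D \<noteq> {}"
    using C D interior_empty by (auto simp: convex_body_def)
  \<comment> \<open>A maximizer lying in both bodies would force equal support values and so a
    common tangent through a common point.\<close>
  have leave: "\<exists>p\<in>A - B. dir t \<bullet> p = supp A t"
    if AB: "compact A" "A \<noteq> {}" "compact B" "B \<noteq> {}" "supp B t \<le> supp A t"
      "\<not> (\<exists>L. tangent_line L A \<and> tangent_line L B \<and> L \<inter> (A \<inter> B) \<noteq> {})" for A B t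
  proof -
    obtain p where p: "p \<in> A" "dir t \<bullet> p = supp A t" using supp_attained[OF AB(1,2)] by blast
    have "p \<notin> B"
    proof
      assume pB: "p \<in> B"
      then have "supp B t = supp A t" using supp_ge[of B p t] AB p by simp
      then have "tangent_line {x. dir t \<bullet> x = supp A t} A" "tangent_line {x. dir t \<bullet> x = supp A t} B"
        using tangent_line_supp[of A t] tangent_line_supp[of B t] AB by simp_all
      then show False using AB(6) p pB by blast
    qed
    then show ?thesis using p by blast
  qed
  have tang': "\<not> (\<exists>L. tangent_line L D \<and> tangent_line L C \<and> L \<inter> (D \<inter> C) \<noteq> {})"
    using tang by (metis Int_commute)
  obtain p1 p3 where p: "p1 \<in> C - D" "dir \<theta>1 \<bullet> p1 = supp C \<theta>1" "p3 \<in> C - D" "dir \<theta>3 \<bullet> p3 = supp C \<theta>3"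
    using leave[of C D] cpt le tang by metis
  obtain q2 q4 where q: "q2 \<in> D - C" "dir \<theta>2 \<bullet> q2 = supp D \<theta>2" "q4 \<in> D - C" "dir \<theta>4 \<bullet> q4 = supp D \<theta>4"
    using leave[of D C] cpt le tang' by metis
  have dom: "dir t \<bullet> y \<le> supp C t" if "y \<in> D" "supp D t \<le> supp C t" for y t
    using supp_ge[OF cpt(4) that(1), of t] that(2) by linarith
  have dom': "dir t \<bullet> y \<le> supp D t" if "y \<in> C" "supp C t \<le> supp D t" for y t
    using supp_ge[OF cpt(1) that(1), of t] that(2) by linarith
  have cross: "closed_segment p1 p3 \<inter> closed_segment q2 q4 \<noteq> {}"
    by (rule alternating_maximizers_cross[OF \<theta>]) (use p q le dom dom' in auto)
  then obtain x where "x \<in> closed_segment p1 p3" "x \<in> closed_segment q2 q4" by blast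
  then have x: "x \<in> C" "x \<in> D"
    using p q cpt closed_segment_subset by blast+
  \<comment> \<open>Otherwise a line separates the bodies; it passes through their common point
    \<open>x\<close> and is a common tangent meeting \<open>C \<inter> D\<close>.\<close>
  have "interior C \<inter> interior D \<noteq> {}"
  proof
    assume "interior C \<inter> interior D = {}"
    then obtain a b where ab: "a \<noteq> 0" "\<forall>x\<in>interior C. a \<bullet> x \<le> b" "\<forall>x\<in>interior D. b \<le> a \<bullet> x"
      using separating_hyperplane_sets[of "interior C" "interior D"] cpt convex_interior by blast
    have "closure (interior C) \<subseteq> {x. a \<bullet> x \<le> b}"
      using ab(2) by (intro closure_minimal closed_halfspace_le) auto
    moreover have "closure (interior D) \<subseteq> {x. b \<le> a \<bullet> x}"
      using ab(3) by (intro closure_minimal closed_halfspace_ge) auto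
    moreover have "closure (interior C) = C" "closure (interior D) = D"
      using cpt by (simp_all add: convex_closure_interior compact_imp_closed)
    ultimately have le: "\<forall>x\<in>C. a \<bullet> x \<le> b" "\<forall>x\<in>D. b \<le> a \<bullet> x" by auto
    then have eq: "a \<bullet> x = b" using x by force
    have "tangent_line {x. a \<bullet> x = b} C"
      unfolding tangent_line_def using ab(1) le(1) eq x by blast
    moreover have "tangent_line {x. a \<bullet> x = b} D"
      unfolding tangent_line_def
      by (rule exI[of _ "- a"], rule exI[of _ "- b"]) (use ab(1) le(2) eq x in auto)
    ultimately show False using tang eq x by blast
  qed
  then obtain Y where "Y \<subseteq> frontier C \<inter> frontier D" "card Y = 4"
    using crossing_segments_frontier[of C D p1 p3 q2 q4] cpt p q cross by blast
  then show False using noncr card_mono[OF noncr(1), of Y] by simp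
qed

section \<open>Families of bodies\<close>

text \<open>The ends \<open>a\<close> and \<open>b\<close> are the first and last points with
  \<open>g \<ge> 0\<close>, zeros of \<open>g\<close> by the intermediate value theorem. A point
  with \<open>g \<le> 0\<close> strictly between them would complete the sign pattern excluded by
  \<open>no\<close>.\<close>

lemma positive_set_interval:
  fixes g :: "real \<Rightarrow> real"
  assumes cont: "continuous_on {0..R} g" and neg: "g 0 < 0" "g R < 0"
    and pos: "\<exists>t\<in>{0..R}. 0 < g t"
    and no: "\<And>t1 t2 t3. \<lbrakk>0 \<le> t1; t1 < t2; t2 < t3; t3 \<le> R; 0 \<le> g t1; g t2 \<le> 0; 0 \<le> g t3\<rbrakk> \<Longrightarrow> False"
  shows "\<exists>a b. 0 < a \<and> a < b \<and> b < R \<and>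
    (\<forall>t\<in>{0..R}. (0 < g t \<longleftrightarrow> a < t \<and> t < b) \<and> (g t < 0 \<longleftrightarrow> t < a \<or> b < t))"
proof -
  define S where "S = {t \<in> {0..R}. 0 \<le> g t}"
  obtain t0 where t0: "t0 \<in> {0..R}" "0 < g t0" using pos by blast
  have S0: "t0 \<in> S" "S \<subseteq> {0..R}" using t0 by (auto simp: S_def)
  have "closed S"
    unfolding S_def using cont by (intro continuous_on_closed_Collect_le) auto
  then have S: "compact S" "S \<noteq> {}" "bdd_below S" "bdd_above S"
    using S0 compact_Int_closed[of "{0..R}" S] by (auto simp: Int_absorb1 intro: bdd_below_mono bdd_above_mono)
  define a where "a = Inf S"
  define b where "b = Sup S"
  have "a \<in> S" "b \<in> S"
    using S \<open>closed S\<close> by (auto simp: a_def b_def closed_contains_Inf closed_contains_Sup)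
  then have ab: "0 \<le> a" "a \<le> R" "0 \<le> g a" "0 \<le> b" "b \<le> R" "0 \<le> g b" by (auto simp: S_def)
  have out: "g t < 0" if "t \<in> {0..R}" "t < a \<or> b < t" for t
  proof (rule ccontr)
    assume "\<not> g t < 0"
    then have "t \<in> S" using that by (simp add: S_def)
    then have "a \<le> t" "t \<le> b" using S by (auto simp: a_def b_def cInf_lower cSup_upper)
    then show False using that by auto
  qed
  have "g a = 0"
  proof -
    have "continuous_on {0..a} g" using cont by (rule continuous_on_subset) (use ab in auto)
    then obtain t where "0 \<le> t" "t \<le> a" "g t = 0"
      using IVT'[of g 0 0 a] neg ab by auto
    then show ?thesis using out[of t] ab by (cases "t = a") auto
  qed
  moreover have "g b = 0"
  proof -
    have "continuous_on {b..R} g" using cont by (rule continuous_on_subset) (use ab in auto)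
    then obtain t where "b \<le> t" "t \<le> R" "g t = 0"
      using IVT2'[of g R 0 b] neg ab by auto
    then show ?thesis using out[of t] ab by (cases "t = b") auto
  qed
  moreover from calculation have "a < t0" "t0 < b"
    using out[OF t0(1)] t0(2) by (metis linorder_less_linear order.asym order.irrefl)+
  moreover have "0 < g t" if "a < t" "t < b" for t
    using no[OF ab(1) that ab(5,3) _ ab(6)] by fastforce
  ultimately show ?thesis
    using ab out neg
    by (intro exI[of _ a] exI[of _ b]) (smt (verit) atLeastAtMost_iff)
qed

text \<open>Four ties within one turn satisfy all four weak inequalities, so there are at most
  three.\<close>

lemma finite_supp_eq:
  assumes "\<And>\<theta>1 \<theta>2 \<theta>3 \<theta>4. \<lbrakk>\<theta>1 < \<theta>2; \<theta>2 < \<theta>3; \<theta>3 < \<theta>4; \<theta>4 < \<theta>1 + 2 * pi;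
      supp D \<theta>1 \<le> supp C \<theta>1; supp C \<theta>2 \<le> supp D \<theta>2;
      supp D \<theta>3 \<le> supp C \<theta>3; supp C \<theta>4 \<le> supp D \<theta>4\<rbrakk> \<Longrightarrow> False"
  shows "finite {\<theta> \<in> {0..<2 * pi}. supp C \<theta> = supp D \<theta>}" (is "finite ?Z")
proof (rule ccontr)
  assume "infinite ?Z"
  then obtain T where T: "finite T" "card T = 4" "T \<subseteq> ?Z"
    using infinite_arbitrarily_large by blast
  define xs where "xs = sorted_list_of_set T"
  have xs: "length xs = 4" "sorted_wrt (<) xs" "set xs = T"
    using T by (auto simp: xs_def)
  have lt: "xs ! i < xs ! j" if "i < j" "j < 4" for i j
    using sorted_wrt_nth_less[OF xs(2) that(1)] xs(1) that by simp
  have Z: "xs ! i \<in> ?Z" if "i < 4" for i using nth_mem[of i xs] xs T that by auto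
  show False
    by (rule assms[of "xs ! 0" "xs ! 1" "xs ! 2" "xs ! 3"])
      (use lt[of 0 1] lt[of 1 2] lt[of 2 3] Z[of 0] Z[of 1] Z[of 2] Z[of 3] in auto)
qed

lemma decreasing_enumeration:
  fixes g :: "'a \<Rightarrow> real"
  assumes "finite F" "inj_on g F"
  shows "\<exists>B. bij_betw B {1..card F} F \<and>
    (\<forall>i\<in>{1..card F}. \<forall>j\<in>{1..card F}. i < j \<longrightarrow> g (B j) < g (B i))"
proof -
  define xs where "xs = rev (sorted_list_of_set (g ` F))"
  have xs: "length xs = card F" "sorted_wrt (>) xs" "distinct xs" "set xs = g ` F"
    using assms by (auto simp: xs_def card_image sorted_wrt_rev)
  define B where "B i = inv_into F g (xs ! (i - 1))" for i
  have nth: "xs ! (i - 1) \<in> g ` F" if "i \<in> {1..card F}" for i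
    using nth_mem[of "i - 1" xs] xs that by auto
  have gB: "g (B i) = xs ! (i - 1)" "B i \<in> F" if "i \<in> {1..card F}" for i
    using nth[OF that] by (auto simp: B_def f_inv_into_f inv_into_into)
  have dec: "g (B j) < g (B i)" if "i \<in> {1..card F}" "j \<in> {1..card F}" "i < j" for i j
    using sorted_wrt_nth_less[OF xs(2), of "i - 1" "j - 1"] gB xs that by auto
  have "inj_on B {1..card F}"
    by (rule linorder_inj_onI) (use dec in fastforce)+
  moreover from this have "B ` {1..card F} = F"
    using gB assms by (intro card_subset_eq) (auto simp: card_image)
  ultimately show ?thesis using dec unfolding bij_betw_def by blast
qed

text \<open>A line strictly separates some point of \<open>C\<close> from the hull; its normal on
  the side of that point is the wanted direction.\<close>

lemma visible_direction:
  assumes body: "compact C" "compact D" "D \<noteq> {}" "compact E" "E \<noteq> {}"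
    and "\<not> C \<subseteq> convex hull (D \<union> E)"
  shows "\<exists>t\<in>{0..2 * pi}. supp D (\<theta> + t) < supp C (\<theta> + t) \<and> supp E (\<theta> + t) < supp C (\<theta> + t)"
proof -
  obtain x where x: "x \<in> C" "x \<notin> convex hull (D \<union> E)" using assms by blast
  have "compact (convex hull (D \<union> E))" using body by (intro compact_convex_hull compact_Un)
  then obtain a b where ab: "a \<bullet> x < b" "\<forall>y\<in>convex hull (D \<union> E). b < a \<bullet> y"
    using separating_hyperplane_closed_point[OF convex_convex_hull _ x(2)] compact_imp_closed
    by blast
  have "- a \<noteq> 0"
  proof
    assume "- a = 0"
    obtain y where "y \<in> D" using body by blast
    then have "b < a \<bullet> y" using ab hull_subset[of "D \<union> E" convex] by blast
    then show False using ab \<open>- a = 0\<close> by simp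
  qed
  then obtain r \<phi> where r: "0 < r" "- a = r *\<^sub>R dir \<phi>" by (rule polar_decomposition)
  \<comment> \<open>The window runs from \<open>\<theta>\<close> to
    \<open>\<theta> + 2 * pi\<close>, so \<open>\<psi> - \<theta>\<close> is a parameter of the
    circle cut at \<open>\<theta>\<close>.\<close>
  obtain \<psi> where \<psi>: "\<theta> + 2 * pi - 2 * pi < \<psi>" "\<psi> \<le> \<theta> + 2 * pi" "dir \<psi> = dir \<phi>"
    by (rule dir_in_window)
  have "supp S \<psi> < supp C \<psi>" if S: "compact S" "S \<noteq> {}" "S \<subseteq> D \<union> E" for S
  proof -
    obtain y where y: "y \<in> S" "dir \<psi> \<bullet> y = supp S \<psi>" using supp_attained[OF S(1,2)] by blast
    then have "b < a \<bullet> y" using ab hull_subset[of "D \<union> E" convex] S by blast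
    then have "(- a) \<bullet> y < (- a) \<bullet> x" using ab by simp
    then have "dir \<psi> \<bullet> y < dir \<psi> \<bullet> x" unfolding r(2) \<psi>(3) using r(1) by simp
    then show ?thesis using y(2) supp_ge[OF body(1) x(1), of \<psi>] by simp
  qed
  then show ?thesis using body \<psi> by (intro bexI[of _ "\<psi> - \<theta>"]) auto
qed

text \<open>In the direction \<open>\<theta>\<close> the other members, and with them their hull,
  lie in an open half plane that misses a maximizer of \<open>C\<close>.\<close>

lemma convex_positionI:
  assumes "\<And>C. C \<in> G \<Longrightarrow> compact C \<and> C \<noteq> {}"
    and "\<And>C. C \<in> G \<Longrightarrow> \<exists>\<theta>. \<forall>D\<in>G - {C}. supp D \<theta> < supp C \<theta>"
  shows "convex_position G"
  unfolding convex_position_def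
proof
  fix C assume C: "C \<in> G"
  then obtain \<theta> where \<theta>: "\<forall>D\<in>G - {C}. supp D \<theta> < supp C \<theta>" using assms by blast
  obtain x where x: "x \<in> C" "dir \<theta> \<bullet> x = supp C \<theta>"
    using supp_attained assms(1)[OF C] by metis
  have "\<Union> (G - {C}) \<subseteq> {y. dir \<theta> \<bullet> y < supp C \<theta>}"
  proof
    fix y assume "y \<in> \<Union> (G - {C})"
    then obtain D where "D \<in> G - {C}" "y \<in> D" by blast
    then have "dir \<theta> \<bullet> y \<le> supp D \<theta>" "supp D \<theta> < supp C \<theta>"
      using \<theta> supp_ge[of D y \<theta>] assms(1) by auto
    then show "y \<in> {y. dir \<theta> \<bullet> y < supp C \<theta>}" by simp
  qed
  then have "convex hull (\<Union> (G - {C})) \<subseteq> {y. dir \<theta> \<bullet> y < supp C \<theta>}"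
    by (intro hull_minimal convex_halfspace_lt)
  then show "\<not> C \<subseteq> convex hull \<Union> (G - {C})" using x by force
qed

section \<open>From coloured paths to convex position\<close>

lemma bodies_property_if_monotone_path_property:
  assumes path: "monotone_path_property 3 n N" and n: "3 \<le> n"
  shows "bodies_property n N"
  unfolding bodies_property_def
proof (intro allI impI, elim conjE)
  fix F :: "plane set set"
  assume F: "finite F" "card F = N" "\<forall>C\<in>F. convex_body C" and nc: "noncrossing F"
    and gp: "general_position F"
  have N3: "3 \<le> N" using monotone_path_property_imp_ge[OF path] n by simp
  have cpt: "compact C" "C \<noteq> {}" if "C \<in> F" for C
    using F(3) that interior_empty by (auto simp: convex_body_def)
  have alt: False if "C \<in> F" "D \<in> F" "C \<noteq> D"
      "\<theta>1 < \<theta>2" "\<theta>2 < \<theta>3" "\<theta>3 < \<theta>4" "\<theta>4 < \<theta>1 + 2 * pi"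
      "supp D \<theta>1 \<le> supp C \<theta>1" "supp C \<theta>2 \<le> supp D \<theta>2"
      "supp D \<theta>3 \<le> supp C \<theta>3" "supp C \<theta>4 \<le> supp D \<theta>4" for C D \<theta>1 \<theta>2 \<theta>3 \<theta>4
    using supp_no_alternation[OF _ _ _ _ _ that(4-)] that(1-3) F(3) nc gp
    unfolding noncrossing_def general_position_def by meson
  \<comment> \<open>\<open>Z\<close> collects the finitely many directions in which two support
    functions agree; the circle is cut at a direction outside it.\<close>
  define Z where "Z = (\<Union>C\<in>F. \<Union>D\<in>F - {C}. {\<theta> \<in> {0..<2 * pi}. supp C \<theta> = supp D \<theta>})"
  have "finite {\<theta> \<in> {0..<2 * pi}. supp C \<theta> = supp D \<theta>}"
    if "C \<in> F" "D \<in> F" "C \<noteq> D" for C D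
    by (rule finite_supp_eq, rule alt[OF that])
  then have "finite Z" unfolding Z_def using F(1)
    by (intro finite_UN_I finite_Diff) (blast+)
  moreover have "infinite {0..<2 * pi}" using pi_gt_zero by (intro infinite_Ico) simp
  ultimately have "{0..<2 * pi} - Z \<noteq> {}" by (metis Diff_eq_empty_iff finite_subset)
  then obtain \<theta> where \<theta>: "\<theta> \<in> {0..<2 * pi}" "\<theta> \<notin> Z" by blast
  have "inj_on (\<lambda>C. supp C \<theta>) F"
    using \<theta> by (intro inj_onI) (auto simp: Z_def)
  then obtain B where B: "bij_betw B {1..N} F"
    and dec: "\<And>i j. \<lbrakk>i \<in> {1..N}; j \<in> {1..N}; i < j\<rbrakk> \<Longrightarrow> supp (B j) \<theta> < supp (B i) \<theta>"
    using decreasing_enumeration[OF F(1), of "\<lambda>C. supp C \<theta>"] F(2) by blast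
  have BF: "B i \<in> F" if "i \<in> {1..N}" for i using B that by (auto simp: bij_betw_def)
  have Bneq: "B i \<noteq> B j" if "i \<in> {1..N}" "j \<in> {1..N}" "i \<noteq> j" for i j
    using B that by (auto simp: bij_betw_def dest: inj_onD)
  define f where "f i t = supp (B i) (\<theta> + t)" for i t
  have visible: "\<exists>t\<in>{0..2 * pi}. f j t < f i t \<and> f k t < f i t"
    if ijk: "i \<in> {1..N}" "j \<in> {1..N}" "k \<in> {1..N}" "i \<noteq> j" "i \<noteq> k" "j \<noteq> k" for i j k
  proof -
    have "card {B i, B j, B k} = 3" "{B i, B j, B k} \<subseteq> F" using ijk Bneq BF by auto
    then have "convex_position {B i, B j, B k}" using gp by (auto simp: general_position_def)
    then have "\<not> B i \<subseteq> convex hull \<Union> ({B i, B j, B k} - {B i})"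
      by (auto simp: convex_position_def)
    moreover have "{B i, B j, B k} - {B i} = {B j, B k}" using Bneq ijk by auto
    ultimately have "\<not> B i \<subseteq> convex hull (B j \<union> B k)" by simp
    then show ?thesis unfolding f_def using ijk BF cpt by (intro visible_direction) auto
  qed
  have "\<exists>a b. 0 < a \<and> a < b \<and> b < 2 * pi \<and> (\<forall>t\<in>{0..2 * pi}.
      (f i t < f j t \<longleftrightarrow> a < t \<and> t < b) \<and> (f j t < f i t \<longleftrightarrow> t < a \<or> b < t))"
    if ij: "i \<in> {1..N}" "j \<in> {1..N}" "i < j" for i j
  proof -
    define g where "g t = f j t - f i t" for t
    have "continuous_on {0..2 * pi} g"
      unfolding g_def f_def using ij BF cpt
      by (intro continuous_intros continuous_on_compose2[OF continuous_on_supp[of _ UNIV]]) auto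
    moreover have neg: "g 0 < 0" "g (2 * pi) < 0"
      using dec[OF ij] by (simp_all add: g_def f_def)
    moreover have "\<exists>t\<in>{0..2 * pi}. 0 < g t"
    proof -
      \<comment> \<open>\<open>visible\<close> speaks of three bodies, so a third index is picked;
        \<open>N3\<close> keeps it in range.\<close>
      have "(1 \<noteq> i \<and> 1 \<noteq> j) \<or> (2 \<noteq> i \<and> 2 \<noteq> j) \<or> (3 \<noteq> i \<and> 3 \<noteq> j)" by arith
      then obtain k where "k \<in> {1, 2, 3}" "k \<noteq> i" "k \<noteq> j" by blast
      moreover from this have "k \<in> {1..N}" using N3 by auto
      ultimately obtain t where "t \<in> {0..2 * pi}" "f i t < f j t"
        using visible[of j i k] ij by auto
      then show ?thesis by (intro bexI[of _ t]) (simp_all add: g_def)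
    qed
    \<comment> \<open>At the cut \<open>B i\<close> is above \<open>B j\<close>, so
      \<open>\<theta>\<close> is the first of four alternating angles. As \<open>g\<close> is
      negative at both ends, \<open>t1\<close> and \<open>t3\<close> stay strictly inside, which
      keeps the four angles within one turn.\<close>
    moreover have False if t: "0 \<le> t1" "t1 < t2" "t2 < t3" "t3 \<le> 2 * pi"
        "0 \<le> g t1" "g t2 \<le> 0" "0 \<le> g t3" for t1 t2 t3
    proof (rule alt[of "B i" "B j" \<theta> "\<theta> + t1" "\<theta> + t2" "\<theta> + t3"])
      show "\<theta> < \<theta> + t1" using t neg by (cases "t1 = 0") auto
      show "\<theta> + t3 < \<theta> + 2 * pi" using t neg by (cases "t3 = 2 * pi") auto
    qed (use t ij BF Bneq dec[OF ij] in \<open>auto simp: g_def f_def\<close>)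
    ultimately have "\<exists>a b. 0 < a \<and> a < b \<and> b < 2 * pi \<and> (\<forall>t\<in>{0..2 * pi}.
        (0 < g t \<longleftrightarrow> a < t \<and> t < b) \<and> (g t < 0 \<longleftrightarrow> t < a \<or> b < t))"
      by (rule positive_set_interval)
    then show ?thesis by (simp add: g_def)
  qed
  then have "\<exists>a b. \<forall>i j. i \<in> {1..N} \<and> j \<in> {1..N} \<and> i < j \<longrightarrow>
      0 < a i j \<and> a i j < b i j \<and> b i j < 2 * pi \<and> (\<forall>t\<in>{0..2 * pi}.
      (f i t < f j t \<longleftrightarrow> a i j < t \<and> t < b i j) \<and> (f j t < f i t \<longleftrightarrow> t < a i j \<or> b i j < t))"
    by metis
  then obtain a b where ab: "\<And>i j. \<lbrakk>i \<in> {1..N}; j \<in> {1..N}; i < j\<rbrakk> \<Longrightarrow>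
      0 < a i j \<and> a i j < b i j \<and> b i j < 2 * pi \<and> (\<forall>t\<in>{0..2 * pi}.
      (f i t < f j t \<longleftrightarrow> a i j < t \<and> t < b i j) \<and> (f j t < f i t \<longleftrightarrow> t < a i j \<or> b i j < t))"
    by blast
  interpret pseudocircles "{1..N}" "2 * pi" f a b
  proof
    fix i j k :: nat
    assume ijk: "i \<in> {1..N}" "j \<in> {1..N}" "k \<in> {1..N}" "i < j" "j < k"
    show "\<exists>t\<in>{0..2 * pi}. f i t < f j t \<and> f k t < f j t" using visible[of j i k] ijk by auto
    show "\<exists>t\<in>{0..2 * pi}. f i t < f k t \<and> f j t < f k t" using visible[of k i j] ijk by auto
    fix t
    show "\<not> (f i t = f j t \<and> f j t = f k t)"
    proof
      assume eq: "f i t = f j t \<and> f j t = f k t"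
      have "tangent_line {x. dir (\<theta> + t) \<bullet> x = f i t} C" if "C \<in> {B i, B j, B k}" for C
        using that eq tangent_line_supp[of C "\<theta> + t"] cpt[of C] BF ijk by (auto simp: f_def)
      moreover have "card {B i, B j, B k} = 3" "{B i, B j, B k} \<subseteq> F" using ijk Bneq BF by auto
      moreover have "\<forall>G\<subseteq>F. card G = 3 \<longrightarrow> \<not> (\<exists>L. \<forall>C\<in>G. tangent_line L C)"
        using gp unfolding general_position_def by (elim conjE)
      ultimately show False by metis
    qed
  qed (use ab in auto)
  \<comment> \<open>Colourings act on sets; minimum, second smallest element and maximum recover the
    ordered triple.\<close>
  define col where "col T = pattern (Min T) (Min (T - {Min T})) (Max T)" for T
  have col: "col {i, j, k} = pattern i j k" if "i < j" "j < k" for i j k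
  proof -
    have "Min {i, j, k} = i" "Max {i, j, k} = k" "{i, j, k} - {i} = {j, k}" "Min {j, k} = j"
      using that by auto
    then show ?thesis by (simp add: col_def)
  qed
  have col3: "\<forall>T\<subseteq>{1..N}. card T = 3 \<longrightarrow> col T \<in> {1..3}" by (simp add: col_def pattern_def)
  obtain p c where p: "strict_mono_on {1..n} p" "p ` {1..n} \<subseteq> {1..N}"
    and c: "\<And>r. r \<in> {1..n - 2} \<Longrightarrow> col {p r, p (r + 1), p (r + 2)} = c"
    using path[unfolded monotone_path_property_def, THEN spec, THEN mp, OF col3] by blast
  have "pattern (p r) (p (r + 1)) (p (r + 2)) = c" if "r \<in> {1..n - 2}" for r
  proof -
    have "r \<in> {1..n}" "r + 1 \<in> {1..n}" "r + 2 \<in> {1..n}" using that by auto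
    then have "p r < p (r + 1)" "p (r + 1) < p (r + 2)"
      using p(1) unfolding strict_mono_on_def by simp_all
    then show ?thesis using col c[OF that] by simp
  qed
  then have vis: "\<exists>t\<in>{0..2 * pi}. \<forall>i\<in>{1..n} - {m}. f (p i) t < f (p m) t" if "m \<in> {1..n}" for m
    using visible_if_pattern_path[OF p _ that n] by blast
  define G where "G = B ` p ` {1..n}"
  have "inj_on p {1..n}" "inj_on B (p ` {1..n})"
    using strict_mono_on_imp_inj_on[OF p(1)] B p(2) inj_on_subset by (auto simp: bij_betw_def)
  then have "card G = n" by (simp add: G_def card_image)
  moreover have "G \<subseteq> F" using p(2) BF by (auto simp: G_def)
  moreover have "convex_position G"
  proof (rule convex_positionI)
    fix C assume "C \<in> G"
    then show "compact C \<and> C \<noteq> {}" using \<open>G \<subseteq> F\<close> cpt by blast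
    obtain m where m: "m \<in> {1..n}" "C = B (p m)" using \<open>C \<in> G\<close> by (auto simp: G_def)
    obtain t where "\<forall>i\<in>{1..n} - {m}. f (p i) t < f (p m) t" using vis[OF m(1)] by blast
    then have "\<forall>D\<in>G - {C}. supp D (\<theta> + t) < supp C (\<theta> + t)"
      using m by (auto simp: G_def f_def)
    then show "\<exists>\<theta>. \<forall>D\<in>G - {C}. supp D \<theta> < supp C \<theta>" by blast
  qed
  ultimately show "\<exists>G\<subseteq>F. card G = n \<and> convex_position G" by blast
qed

theorem theorem6:
  fixes n :: nat
  assumes "n \<ge> 3"
  shows "(\<exists>N. bodies_property n N) \<and> (\<exists>N. monotone_path_property 3 n N) \<and>
         M_bodies n \<le> N\<^sub>3 3 n \<and>
         real (N\<^sub>3 3 n) \<le> 2 powr ((real n)\<^sup>2 * log 2 (real n))"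
proof (intro conjI)
  note path = monotone_path_property_3[OF assms]
  then show ex: "\<exists>N. monotone_path_property 3 n N" by blast
  \<comment> \<open>By \<open>ex\<close> the \<open>LEAST\<close> is attained, so
    \<open>N\<^sub>3 3 n\<close> itself has the path property and hence the property for
    bodies.\<close>
  have "bodies_property n (N\<^sub>3 3 n)"
    unfolding N\<^sub>3_def using LeastI_ex[OF ex] assms
    by (rule bodies_property_if_monotone_path_property)
  then show "\<exists>N. bodies_property n N" "M_bodies n \<le> N\<^sub>3 3 n"
    unfolding M_bodies_def by (auto intro: Least_le)
  have "N\<^sub>3 3 n \<le> n ^ n\<^sup>2" unfolding N\<^sub>3_def using path by (rule Least_le)
  then have "real (N\<^sub>3 3 n) \<le> real n ^ n\<^sup>2" by (metis of_nat_le_iff of_nat_power)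
  also have "\<dots> = real n powr (real n)\<^sup>2"
    using assms powr_realpow[of "real n" "n\<^sup>2"] by simp
  also have "\<dots> = (2 powr log 2 (real n)) powr (real n)\<^sup>2" using assms by simp
  also have "\<dots> = 2 powr ((real n)\<^sup>2 * log 2 (real n))" by (simp add: powr_powr mult.commute)
  finally show "real (N\<^sub>3 3 n) \<le> 2 powr ((real n)\<^sup>2 * log 2 (real n))" .
qed

end
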